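(* Let $p\ge1$, $m=2p$, let $\{\beta(k)\}_{k\ge0}$ be $p\times m$ matrices with $\beta(k)J\beta(k)^*=I_p$, put $C_k=2K^*\beta(k)^*\beta(k)K-j$, and consider the system $W_{k+1}(\lambda)-W_k(\lambda)=-\frac{i}{\lambda}jC_kW_k(\lambda)$ on the semiaxis $k\ge0$. Then there is exactly one function $\varphi_\infty$ belonging to all the sets $\mathcal N(N)$, $N\ge0$: $\bigcap_{N=0}^\infty\mathcal N(N)=\{\varphi_\infty\}$.
   Context: $\mathbb C_-$ is the open lower half-plane; $j=\mathrm{diag}(I_p,-I_p)$, $J=\begin{bmatrix}0&I_p\\ I_p&0\end{bmatrix}$, $K=\frac1{\sqrt2}\begin{bmatrix}I_p&-I_p\\ I_p&I_p\end{bmatrix}$. $W_k$ is the solution with $W_0=I_m$. For $N\ge0$ let $\mathcal W(N,\lambda)=\{\mathcal W_{ij}(N,\lambda)\}_{i,j=1}^2=KW_{N+1}(\bar\lambda)^*$ ($p\times p$ blocks), and let $\mathcal N(N)$ (the Weyl disc) be the set of $p\times p$ matrix functions $\varphi$ holomorphic in $\mathbb C_-$ of the form $\varphi=i(\mathcal W_{21}(N,\cdot)R+\mathcal W_{22}(N,\cdot)Q)(\mathcal W_{11}(N,\cdot)R+\mathcal W_{12}(N,\cdot)Q)^{-1}$, where $R,Q$ are $p\times p$ matrix functions meromorphic in $\mathbb C_-$, well defined at $\lambda=-i$, with $R^*R+Q^*Q>0$ and $R^*R\le Q^*Q$. *)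

theory Defs
  imports "HOL-Complex_Analysis.Complex_Analysis"
    "Jordan_Normal_Form.Schur_Decomposition"
    "Jordan_Normal_Form.Gauss_Jordan_Elimination"
begin

definition lower_half :: "complex set" where
  "lower_half = {z. Im z < 0}"

definition jmat :: "nat \<Rightarrow> complex mat" where
  "jmat p = four_block_mat (1\<^sub>m p) (0\<^sub>m p p) (0\<^sub>m p p) (- 1\<^sub>m p)"

definition Jmat :: "nat \<Rightarrow> complex mat" where
  "Jmat p = four_block_mat (0\<^sub>m p p) (1\<^sub>m p) (1\<^sub>m p) (0\<^sub>m p p)"

definition Kmat :: "nat \<Rightarrow> complex mat" where
  "Kmat p = (complex_of_real (1 / sqrt 2)) \<cdot>\<^sub>m
     four_block_mat (1\<^sub>m p) (- 1\<^sub>m p) (1\<^sub>m p) (1\<^sub>m p)"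

definition Cmat :: "nat \<Rightarrow> (nat \<Rightarrow> complex mat) \<Rightarrow> nat \<Rightarrow> complex mat" where
  "Cmat p \<beta> k = 2 \<cdot>\<^sub>m (mat_adjoint (Kmat p) * mat_adjoint (\<beta> k) * \<beta> k * Kmat p) - jmat p"

fun Wsol :: "nat \<Rightarrow> (nat \<Rightarrow> complex mat) \<Rightarrow> nat \<Rightarrow> complex \<Rightarrow> complex mat" where
  "Wsol p \<beta> 0 l = 1\<^sub>m (2 * p)"
| "Wsol p \<beta> (Suc k) l =
     Wsol p \<beta> k l - (\<i> / l) \<cdot>\<^sub>m (jmat p * Cmat p \<beta> k * Wsol p \<beta> k l)"

definition calW :: "nat \<Rightarrow> (nat \<Rightarrow> complex mat) \<Rightarrow> nat \<Rightarrow> complex \<Rightarrow> complex mat" where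
  "calW p \<beta> N l = Kmat p * mat_adjoint (Wsol p \<beta> (Suc N) (cnj l))"

definition calW11 where "calW11 p \<beta> N l = fst (split_block (calW p \<beta> N l) p p)"
definition calW12 where "calW12 p \<beta> N l = fst (snd (split_block (calW p \<beta> N l) p p))"
definition calW21 where "calW21 p \<beta> N l = fst (snd (snd (split_block (calW p \<beta> N l) p p)))"
definition calW22 where "calW22 p \<beta> N l = snd (snd (snd (split_block (calW p \<beta> N l) p p)))"

definition pos_def_mat :: "nat \<Rightarrow> complex mat \<Rightarrow> bool" where
  "pos_def_mat n A \<longleftrightarrow> A \<in> carrier_mat n n \<and> mat_adjoint A = A \<and>
     (\<forall>v \<in> carrier_vec n. v \<noteq> 0\<^sub>v n \<longrightarrow> Re (conjugate v \<bullet> (A *\<^sub>v v)) > 0)"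

definition pos_semidef_mat :: "nat \<Rightarrow> complex mat \<Rightarrow> bool" where
  "pos_semidef_mat n A \<longleftrightarrow> A \<in> carrier_mat n n \<and> mat_adjoint A = A \<and>
     (\<forall>v \<in> carrier_vec n. Re (conjugate v \<bullet> (A *\<^sub>v v)) \<ge> 0)"

definition mat_holomorphic_on :: "nat \<Rightarrow> (complex \<Rightarrow> complex mat) \<Rightarrow> complex set \<Rightarrow> bool" where
  "mat_holomorphic_on n F S \<longleftrightarrow> (\<forall>z\<in>S. F z \<in> carrier_mat n n) \<and>
     (\<forall>a<n. \<forall>b<n. (\<lambda>z. F z $$ (a, b)) holomorphic_on S)"

definition mat_meromorphic_on :: "nat \<Rightarrow> (complex \<Rightarrow> complex mat) \<Rightarrow> complex set \<Rightarrow> bool" where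
  "mat_meromorphic_on n F S \<longleftrightarrow> (\<forall>z\<in>S. F z \<in> carrier_mat n n) \<and>
     (\<forall>a<n. \<forall>b<n. (\<lambda>z. F z $$ (a, b)) meromorphic_on S)"

definition mat_analytic_at :: "nat \<Rightarrow> (complex \<Rightarrow> complex mat) \<Rightarrow> complex \<Rightarrow> bool" where
  "mat_analytic_at n F z \<longleftrightarrow> (\<forall>a<n. \<forall>b<n. (\<lambda>w. F w $$ (a, b)) analytic_on {z})"

definition Weyl_disc :: "nat \<Rightarrow> (nat \<Rightarrow> complex mat) \<Rightarrow> nat \<Rightarrow> (complex \<Rightarrow> complex mat) set" where
  "Weyl_disc p \<beta> N = {\<phi>. mat_holomorphic_on p \<phi> lower_half \<and>
     (\<exists>R Q. mat_meromorphic_on p R lower_half \<and> mat_meromorphic_on p Q lower_half \<and>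
        mat_analytic_at p R (- \<i>) \<and> mat_analytic_at p Q (- \<i>) \<and>
        (\<forall>z\<in>lower_half. mat_analytic_at p R z \<and> mat_analytic_at p Q z \<longrightarrow>
           pos_def_mat p (mat_adjoint (R z) * R z + mat_adjoint (Q z) * Q z) \<and>
           pos_semidef_mat p (mat_adjoint (Q z) * Q z - mat_adjoint (R z) * R z) \<and>
           (let D = calW11 p \<beta> N z * R z + calW12 p \<beta> N z * Q z;
                U = calW21 p \<beta> N z * R z + calW22 p \<beta> N z * Q z
            in det D \<noteq> 0 \<and> \<phi> z = \<i> \<cdot>\<^sub>m (U * the (mat_inverse D)))))}"

end

theory Submission
  imports Defs
begin

text \<open>
  Put \<open>T\<^sub>k = 1 + a C\<^sub>k j\<close> with \<open>a = \<i> / z\<close>, so that \<open>calW N z = K T\<^sub>0 \<dots> T\<^sub>N\<close>, and let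
  \<open>G\<^sub>k = j C\<^sub>k j\<close>, \<open>q = 1 + |a|\<^sup>2\<close>, \<open>r = - Re a > 0\<close>. From \<open>C\<^sub>k j C\<^sub>k = j\<close> one gets
  \<open>T\<^sub>k\<^sup>* j T\<^sub>k = q j - 2 r G\<^sub>k\<close>, and \<open>G\<^sub>k\<close> is positive definite and dominates \<open>\<plusminus>j\<close>. Hence
  \<open>T\<^sub>k\<close> maps \<open>j\<close>-nonpositive vectors to \<open>j\<close>-negative ones, and along a chain
  \<open>v\<^sub>k = T\<^sub>k v\<^sub>k\<^sub>+\<^sub>1\<close> ending in a \<open>j\<close>-nonpositive vector the sum of \<open>q\<^sup>k G\<^sub>k(v\<^sub>k\<^sub>+\<^sub>1)\<close> is bounded by
  the initial \<open>j\<close>-form. For the difference of two elements of one disc the chain starts at a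
  \<open>j\<close>-neutral vector, so \<open>q\<^sup>k j(v\<^sub>k)\<close> is nondecreasing and the same sum grows linearly in \<open>N\<close>:
  the diameter of the \<open>N\<close>-th disc is \<open>O(N\<^sup>-\<^sup>1\<^sup>/\<^sup>2)\<close>, locally uniformly in \<open>z\<close>, including the point
  \<open>z = - \<i>\<close> at which every \<open>T\<^sub>k\<close> is singular.

  Therefore the fractions with \<open>R = 0\<close>, \<open>Q = 1\<close> converge to a holomorphic function. Applied to the
  system started at index \<open>N + 1\<close> this also yields, through \<open>K\<^sup>*\<close>, a parameter pair that exhibits
  the limit as an element of the \<open>N\<close>-th disc.
\<close>

section \<open>Complex matrices and quadratic forms\<close>

text \<open>Conjugate-linear in the first argument. The summation range comes from the second
  vector, so linearity in that argument holds for every \<open>u\<close>.\<close>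

definition ip :: "complex vec \<Rightarrow> complex vec \<Rightarrow> complex" where
  "ip u v = (\<Sum>i<dim_vec v. cnj (u $ i) * v $ i)"

abbreviation nsq :: "complex vec \<Rightarrow> real" where
  "nsq v \<equiv> Re (ip v v)"

lemma scalar_prod_conjugate_eq_ip:
  "dim_vec u = dim_vec v \<Longrightarrow> conjugate u \<bullet> v = ip u v"
  by (simp add: scalar_prod_def ip_def atLeast0LessThan)

lemma nsq_eq_sum: "nsq v = (\<Sum>i<dim_vec v. (cmod (v $ i))\<^sup>2)"
  by (simp add: ip_def cmod_power2 flip: power2_eq_square)

lemma nsq_nonneg: "0 \<le> nsq v"
  unfolding nsq_eq_sum by (simp add: sum_nonneg)

lemma nsq_eq_0_iff: "v \<in> carrier_vec n \<Longrightarrow> nsq v = 0 \<longleftrightarrow> v = 0\<^sub>v n"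
  by (auto simp: nsq_eq_sum sum_nonneg_eq_0_iff)

lemma cmod_index_le_nsq: "i < dim_vec v \<Longrightarrow> (cmod (v $ i))\<^sup>2 \<le> nsq v"
  unfolding nsq_eq_sum by (rule member_le_sum) auto

lemma cnj_ip: "dim_vec u = dim_vec v \<Longrightarrow> cnj (ip u v) = ip v u"
  by (simp add: ip_def mult.commute)

lemma Re_ip_commute: "dim_vec u = dim_vec v \<Longrightarrow> Re (ip u v) = Re (ip v u)"
  using cnj_ip[of u v, symmetric] by simp

lemma ip_add_right: "v \<in> carrier_vec n \<Longrightarrow> w \<in> carrier_vec n \<Longrightarrow> ip u (v + w) = ip u v + ip u w"
  by (simp add: ip_def algebra_simps sum.distrib)

lemma ip_add_left: "u \<in> carrier_vec n \<Longrightarrow> v \<in> carrier_vec n \<Longrightarrow> w \<in> carrier_vec n \<Longrightarrow>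
  ip (u + v) w = ip u w + ip v w"
  by (simp add: ip_def algebra_simps sum.distrib)

lemma ip_diff_right: "v \<in> carrier_vec n \<Longrightarrow> w \<in> carrier_vec n \<Longrightarrow> ip u (v - w) = ip u v - ip u w"
  by (simp add: ip_def algebra_simps sum_subtractf)

lemma ip_diff_left: "u \<in> carrier_vec n \<Longrightarrow> v \<in> carrier_vec n \<Longrightarrow> w \<in> carrier_vec n \<Longrightarrow>
  ip (u - v) w = ip u w - ip v w"
  by (simp add: ip_def algebra_simps sum_subtractf)

lemma ip_smult_right: "ip u (c \<cdot>\<^sub>v v) = c * ip u v"
  by (simp add: ip_def sum_distrib_left algebra_simps)

lemma ip_smult_left: "u \<in> carrier_vec n \<Longrightarrow> v \<in> carrier_vec n \<Longrightarrow> ip (c \<cdot>\<^sub>v u) v = cnj c * ip u v"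
  by (simp add: ip_def sum_distrib_left algebra_simps)

lemma ip_zero_left [simp]: "v \<in> carrier_vec n \<Longrightarrow> ip (0\<^sub>v n) v = 0"
  by (simp add: ip_def)

lemma ip_append:
  assumes "a \<in> carrier_vec n" "b \<in> carrier_vec m" "c \<in> carrier_vec n" "d \<in> carrier_vec m"
  shows "ip (a @\<^sub>v b) (c @\<^sub>v d) = ip a c + ip b d"
proof -
  have "ip (a @\<^sub>v b) (c @\<^sub>v d) = conjugate (a @\<^sub>v b) \<bullet> (c @\<^sub>v d)"
    using assms by (simp add: scalar_prod_conjugate_eq_ip)
  also have "conjugate (a @\<^sub>v b) = conjugate a @\<^sub>v conjugate b"
    by (intro eq_vecI) auto
  also have "\<dots> \<bullet> (c @\<^sub>v d) = ip a c + ip b d"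
    using assms by (subst scalar_prod_append[of _ n _ m]) (auto simp: scalar_prod_conjugate_eq_ip)
  finally show ?thesis .
qed

lemma mat_adjoint_dim [simp]:
  "dim_row (mat_adjoint A) = dim_col A" "dim_col (mat_adjoint A) = dim_row A"
  by (simp_all add: mat_adjoint_def)

lemma mat_adjoint_carrier [simp]: "A \<in> carrier_mat n m \<Longrightarrow> mat_adjoint A \<in> carrier_mat m n"
  by (rule carrier_matI) auto

lemma mat_adjoint_index [simp]:
  fixes A :: "complex mat"
  shows "i < dim_col A \<Longrightarrow> j < dim_row A \<Longrightarrow> mat_adjoint A $$ (i, j) = cnj (A $$ (j, i))"
  by (simp add: mat_adjoint_def mat_of_rows_def)

lemma mat_adjoint_mult:
  fixes A B :: "complex mat"
  assumes "A \<in> carrier_mat n m" "B \<in> carrier_mat m l"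
  shows "mat_adjoint (A * B) = mat_adjoint B * mat_adjoint A"
  using assms by (intro eq_matI) (auto simp: scalar_prod_def mult.commute)

lemma mat_adjoint_minus:
  fixes A B :: "complex mat"
  assumes "A \<in> carrier_mat n m" "B \<in> carrier_mat n m"
  shows "mat_adjoint (A - B) = mat_adjoint A - mat_adjoint B"
  using assms by (intro eq_matI) auto

lemma mat_adjoint_plus:
  fixes A B :: "complex mat"
  assumes "A \<in> carrier_mat n m" "B \<in> carrier_mat n m"
  shows "mat_adjoint (A + B) = mat_adjoint A + mat_adjoint B"
  using assms by (intro eq_matI) auto

lemma mat_adjoint_smult:
  fixes A :: "complex mat"
  shows "mat_adjoint (c \<cdot>\<^sub>m A) = cnj c \<cdot>\<^sub>m mat_adjoint A"
  by (intro eq_matI) auto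

lemma mat_adjoint_adjoint [simp]:
  fixes A :: "complex mat" shows "mat_adjoint (mat_adjoint A) = A"
  by (intro eq_matI) auto

lemma mult_mat_vec_index: "i < dim_row A \<Longrightarrow> dim_vec v = dim_col A \<Longrightarrow>
  (A *\<^sub>v v) $ i = (\<Sum>k<dim_col A. A $$ (i, k) * v $ k)"
  by (auto simp: scalar_prod_def atLeast0LessThan intro: sum.cong)

lemma ip_mat_adjoint:
  assumes A: "A \<in> carrier_mat n m" and u: "u \<in> carrier_vec n" and v: "v \<in> carrier_vec m"
  shows "ip u (A *\<^sub>v v) = ip (mat_adjoint A *\<^sub>v u) v"
proof -
  have "ip u (A *\<^sub>v v) = (\<Sum>i<n. \<Sum>k<m. cnj (u $ i) * (A $$ (i, k) * v $ k))"
    using assms by (simp add: ip_def mult_mat_vec_index sum_distrib_left del: index_mult_mat_vec)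
  also have "\<dots> = (\<Sum>k<m. \<Sum>i<n. cnj (u $ i) * (A $$ (i, k) * v $ k))"
    by (rule sum.swap)
  also have "\<dots> = ip (mat_adjoint A *\<^sub>v u) v"
    using assms by (simp add: ip_def mult_mat_vec_index sum_distrib_right sum_distrib_left mult_ac del: index_mult_mat_vec)
  finally show ?thesis .
qed

text \<open>Expand the nonnegative square of \<open>t u + v\<close> and divide by \<open>t\<close>.
  The weight stays free so that an unwanted \<open>nsq v\<close> can later be absorbed.\<close>

lemma am_gm_ip:
  assumes u: "u \<in> carrier_vec n" and v: "v \<in> carrier_vec n" and t: "t > 0"
  shows "- 2 * Re (ip u v) \<le> t * nsq u + nsq v / t"
proof -
  have "0 \<le> nsq (complex_of_real t \<cdot>\<^sub>v u + v)" by (rule nsq_nonneg)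
  also have "\<dots> = t * (t * nsq u) + 2 * t * Re (ip u v) + nsq v"
    using u v Re_ip_commute[of u v]
    by (simp add: ip_add_left[of _ n] ip_add_right[of _ n] ip_smult_left[of _ n] ip_smult_right algebra_simps)
  finally have "0 \<le> (t * (t * nsq u) + 2 * t * Re (ip u v) + nsq v) / t"
    using t by simp
  thus ?thesis using t by (simp add: field_simps)
qed

lemma quadratic_form_bound:
  assumes A: "A \<in> carrier_mat n n"
  shows "\<exists>B>0. \<forall>v\<in>carrier_vec n. Re (ip v (A *\<^sub>v v)) \<le> B * nsq v"
proof -
  \<comment> \<open>The summand 1 keeps \<open>B\<close> positive even for the zero matrix, so that
    \<open>1 / B\<close> can serve as a constant in \<open>C_lower_bound\<close>.\<close>
  define B where "B = 1 + (\<Sum>i<n. \<Sum>k<n. cmod (A $$ (i, k)))"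
  have B: "B > 0" unfolding B_def by (intro add_pos_nonneg sum_nonneg) auto
  have "Re (ip v (A *\<^sub>v v)) \<le> B * nsq v" if v: "v \<in> carrier_vec n" for v
  proof -
    have "cmod (ip v (A *\<^sub>v v)) = cmod (\<Sum>i<n. \<Sum>k<n. cnj (v $ i) * (A $$ (i, k) * v $ k))"
      using A v by (simp add: ip_def mult_mat_vec_index sum_distrib_left del: index_mult_mat_vec)
    also have "\<dots> \<le> (\<Sum>i<n. \<Sum>k<n. cmod (cnj (v $ i) * (A $$ (i, k) * v $ k)))"
      by (intro order.trans[OF norm_sum] sum_mono order.trans[OF norm_sum]) auto
    also have "\<dots> \<le> (\<Sum>i<n. \<Sum>k<n. cmod (A $$ (i, k)) * nsq v)"
    proof (intro sum_mono)
      fix i k assume "i \<in> {..<n}" "k \<in> {..<n}"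
      hence i: "(cmod (v $ i))\<^sup>2 \<le> nsq v" and k: "(cmod (v $ k))\<^sup>2 \<le> nsq v"
        using v by (auto intro: cmod_index_le_nsq)
      have "2 * (cmod (v $ i) * cmod (v $ k)) \<le> (cmod (v $ i))\<^sup>2 + (cmod (v $ k))\<^sup>2"
        using sum_squares_bound[of "cmod (v $ i)" "cmod (v $ k)"] by simp
      hence "cmod (v $ i) * cmod (v $ k) \<le> nsq v" using i k by linarith
      hence "cmod (A $$ (i, k)) * (cmod (v $ i) * cmod (v $ k)) \<le> cmod (A $$ (i, k)) * nsq v"
        by (rule mult_left_mono) simp
      thus "cmod (cnj (v $ i) * (A $$ (i, k) * v $ k)) \<le> cmod (A $$ (i, k)) * nsq v"
        by (simp add: norm_mult mult_ac)
    qed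
    also have "\<dots> \<le> B * nsq v"
      using nsq_nonneg[of v] by (simp add: B_def sum_distrib_right distrib_right)
    finally show ?thesis using complex_Re_le_cmod order.trans by blast
  qed
  thus ?thesis using B by blast
qed

text \<open>Cramer's rule: the adjugate applied to \<open>w\<close>, divided by the determinant, is
  a solution.\<close>

lemma mult_mat_vec_surj:
  fixes A :: "complex mat"
  assumes A: "A \<in> carrier_mat n n" "det A \<noteq> 0" and w: "w \<in> carrier_vec n"
  shows "\<exists>y\<in>carrier_vec n. A *\<^sub>v y = w"
proof (intro bexI)
  have adj: "adj_mat A \<in> carrier_mat n n" using adj_mat[OF A(1)] by simp
  show y: "(1 / det A) \<cdot>\<^sub>v (adj_mat A *\<^sub>v w) \<in> carrier_vec n" using adj w by simp
  have "A *\<^sub>v ((1 / det A) \<cdot>\<^sub>v (adj_mat A *\<^sub>v w)) = (1 / det A) \<cdot>\<^sub>v ((A * adj_mat A) *\<^sub>v w)"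
    using A adj w by (simp add: mult_mat_vec[OF A(1)])
  also have "(A * adj_mat A) *\<^sub>v w = det A \<cdot>\<^sub>v w"
    unfolding adj_mat(2)[OF A(1)] using w by (intro eq_vecI) auto
  finally show "A *\<^sub>v ((1 / det A) \<cdot>\<^sub>v (adj_mat A *\<^sub>v w)) = w"
    using A(2) by (simp add: smult_smult_assoc)
qed

text \<open>\<open>mat_inverse\<close> returns an option. \<open>None\<close> would mean that
  \<open>A\<close> is no unit of the matrix ring, but the adjugate divided by the determinant is a
  two-sided inverse.\<close>

lemma mat_inverse_det:
  fixes A :: "complex mat"
  assumes A: "A \<in> carrier_mat n n" and d: "det A \<noteq> 0"
  shows "the (mat_inverse A) \<in> carrier_mat n n" "A * the (mat_inverse A) = 1\<^sub>m n"
    "the (mat_inverse A) * A = 1\<^sub>m n"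
proof -
  have "mat_inverse A \<noteq> None"
  proof
    assume None: "mat_inverse A = None"
    define B where "B = (1 / det A) \<cdot>\<^sub>m adj_mat A"
    have B: "B \<in> carrier_mat n n" using adj_mat(1)[OF A] by (simp add: B_def)
    have AB: "A * B = 1\<^sub>m n"
      unfolding B_def mult_smult_distrib[OF A adj_mat(1)[OF A]] adj_mat(2)[OF A]
      using d by (intro eq_matI) auto
    have BA: "B * A = 1\<^sub>m n"
      unfolding B_def mult_smult_assoc_mat[OF adj_mat(1)[OF A] A] adj_mat(3)[OF A]
      using d by (intro eq_matI) auto
    have "A \<in> Units (ring_mat TYPE(complex) n ())"
      using A B AB BA unfolding Units_def ring_mat_def by auto
    thus False using mat_inverse(1)[OF A None, of "()"] by blast
  qed
  then obtain B where "mat_inverse A = Some B" by auto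
  thus "the (mat_inverse A) \<in> carrier_mat n n" "A * the (mat_inverse A) = 1\<^sub>m n"
    "the (mat_inverse A) * A = 1\<^sub>m n"
    using mat_inverse(2)[OF A] by auto
qed

text \<open>Clears the denominator. The linear equation can be tested on vectors and passed to a
  limit, and it links these arguments to the \<open>mat_inverse\<close> in
  \<open>Weyl_disc\<close>.\<close>

lemma fraction_iff:
  fixes D :: "complex mat"
  assumes D: "D \<in> carrier_mat n n" "det D \<noteq> 0" and U: "U \<in> carrier_mat n n" and F: "F \<in> carrier_mat n n"
  shows "F = \<i> \<cdot>\<^sub>m (U * the (mat_inverse D)) \<longleftrightarrow> F * D = \<i> \<cdot>\<^sub>m U"
proof -
  note I = mat_inverse_det[OF D]
  have UI: "U * the (mat_inverse D) \<in> carrier_mat n n" using U I(1) by (rule mult_carrier_mat)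
  show ?thesis
  proof
    assume "F = \<i> \<cdot>\<^sub>m (U * the (mat_inverse D))"
    hence "F * D = \<i> \<cdot>\<^sub>m (U * the (mat_inverse D) * D)"
      using mult_smult_assoc_mat[OF UI D(1)] by simp
    also have "U * the (mat_inverse D) * D = U"
      using assoc_mult_mat[OF U I(1) D(1)] I(3) U by simp
    finally show "F * D = \<i> \<cdot>\<^sub>m U" .
  next
    assume e: "F * D = \<i> \<cdot>\<^sub>m U"
    have "F = F * D * the (mat_inverse D)"
      using assoc_mult_mat[OF F D(1) I(1)] I(2) F by simp
    also have "\<dots> = \<i> \<cdot>\<^sub>m (U * the (mat_inverse D))"
      unfolding e by (rule mult_smult_assoc_mat[OF U I(1)])
    finally show "F = \<i> \<cdot>\<^sub>m (U * the (mat_inverse D))" .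
  qed
qed

lemma mult_unit_vec_index:
  fixes A :: "complex mat"
  assumes "A \<in> carrier_mat n m" "i < n" "l < m"
  shows "(A *\<^sub>v unit_vec m l) $ i = A $$ (i, l)"
proof -
  have "(A *\<^sub>v unit_vec m l) $ i = (\<Sum>k<m. if k = l then A $$ (i, k) else 0)"
    using assms
    by (simp add: mult_mat_vec_index if_distrib[of "(*) x" for x] del: index_mult_mat_vec cong: if_cong)
  also have "\<dots> = A $$ (i, l)" using assms by simp
  finally show ?thesis .
qed

lemma mat_eqI_vec:
  fixes A B :: "complex mat"
  assumes A: "A \<in> carrier_mat n m" and B: "B \<in> carrier_mat n m"
    and eq: "\<And>f. f \<in> carrier_vec m \<Longrightarrow> A *\<^sub>v f = B *\<^sub>v f"
  shows "A = B"
proof (rule eq_matI)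
  fix i l assume il: "i < dim_row B" "l < dim_col B"
  show "A $$ (i, l) = B $$ (i, l)"
    using mult_unit_vec_index[OF A, of i l] mult_unit_vec_index[OF B, of i l] eq[of "unit_vec m l"] il A B
    by simp
qed (use A B in auto)

section \<open>Holomorphic and meromorphic matrix functions\<close>

lemma permutes_lt: "\<pi> permutes {0..<n} \<Longrightarrow> i < n \<Longrightarrow> \<pi> i < (n :: nat)"
  using permutes_in_image[of \<pi> "{0..<n}" i] by simp

text \<open>By the Leibniz formula the determinant is a polynomial in the entries.\<close>

lemma det_holomorphic:
  assumes "\<And>z. z \<in> S \<Longrightarrow> A z \<in> carrier_mat n n"
    and "\<And>i l. i < n \<Longrightarrow> l < n \<Longrightarrow> (\<lambda>z. A z $$ (i, l)) holomorphic_on S"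
  shows "(\<lambda>z. det (A z)) holomorphic_on S"
proof -
  have "(\<lambda>z. \<Sum>\<pi>\<in>{\<pi>. \<pi> permutes {0..<n}}. signof \<pi> * (\<Prod>i = 0..<n. A z $$ (i, \<pi> i))) holomorphic_on S"
    by (intro holomorphic_intros assms(2)) (auto simp: permutes_lt)
  moreover have "(\<Sum>\<pi>\<in>{\<pi>. \<pi> permutes {0..<n}}. signof \<pi> * (\<Prod>i = 0..<n. A z $$ (i, \<pi> i))) = det (A z)"
    if "z \<in> S" for z
    using assms(1)[OF that] by (simp add: det_def)
  ultimately show ?thesis by (rule holomorphic_transform)
qed

text \<open>Each entry of the adjugate is a signed minor; the conditional indices in the proof skip
  row \<open>b\<close> and column \<open>a\<close>.\<close>

lemma adj_mat_holomorphic: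
  assumes A: "\<And>z. z \<in> S \<Longrightarrow> A z \<in> carrier_mat n n"
    and h: "\<And>i l. i < n \<Longrightarrow> l < n \<Longrightarrow> (\<lambda>z. A z $$ (i, l)) holomorphic_on S"
    and ab: "a < n" "b < n"
  shows "(\<lambda>z. adj_mat (A z) $$ (a, b)) holomorphic_on S"
proof -
  have "(\<lambda>z. det (mat_delete (A z) b a)) holomorphic_on S"
  proof (rule det_holomorphic[of _ _ "n - 1"])
    show "mat_delete (A z) b a \<in> carrier_mat (n - 1) (n - 1)" if "z \<in> S" for z
      using mat_delete_carrier[OF A[OF that]] .
    fix i l assume il: "i < n - 1" "l < n - 1"
    have "(\<lambda>z. A z $$ (if i < b then i else Suc i, if l < a then l else Suc l)) holomorphic_on S"
      using il by (intro h) auto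
    moreover have "A z $$ (if i < b then i else Suc i, if l < a then l else Suc l) = mat_delete (A z) b a $$ (i, l)"
      if "z \<in> S" for z
      using il A[OF that] by (simp add: mat_delete_def)
    ultimately show "(\<lambda>z. mat_delete (A z) b a $$ (i, l)) holomorphic_on S"
      by (rule holomorphic_transform)
  qed
  hence "(\<lambda>z. (- 1) ^ (b + a) * det (mat_delete (A z) b a)) holomorphic_on S"
    by (intro holomorphic_intros)
  moreover have "(- 1) ^ (b + a) * det (mat_delete (A z) b a) = adj_mat (A z) $$ (a, b)" if "z \<in> S" for z
    using ab A[OF that] by (simp add: adj_mat_def cofactor_def)
  ultimately show ?thesis by (rule holomorphic_transform)
qed

lemma mat_mult_holomorphic:
  assumes A: "\<And>z. z \<in> S \<Longrightarrow> A z \<in> carrier_mat n m" and B: "\<And>z. z \<in> S \<Longrightarrow> B z \<in> carrier_mat m l"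
    and hA: "\<And>i k. i < n \<Longrightarrow> k < m \<Longrightarrow> (\<lambda>z. A z $$ (i, k)) holomorphic_on S"
    and hB: "\<And>i k. i < m \<Longrightarrow> k < l \<Longrightarrow> (\<lambda>z. B z $$ (i, k)) holomorphic_on S"
    and ab: "a < n" "b < l"
  shows "(\<lambda>z. (A z * B z) $$ (a, b)) holomorphic_on S"
proof -
  have "(\<lambda>z. \<Sum>k<m. A z $$ (a, k) * B z $$ (k, b)) holomorphic_on S"
    using ab by (intro holomorphic_intros hA hB) auto
  moreover have "(\<Sum>k<m. A z $$ (a, k) * B z $$ (k, b)) = (A z * B z) $$ (a, b)" if "z \<in> S" for z
    using ab A[OF that] B[OF that] by (simp add: scalar_prod_def atLeast0LessThan)
  ultimately show ?thesis by (rule holomorphic_transform)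
qed

lemma tendsto_mult_mat_vec:
  fixes A :: "'b \<Rightarrow> complex mat" and x :: "'b \<Rightarrow> complex Matrix.vec" and x' :: "complex Matrix.vec"
  assumes A: "\<And>k. A k \<in> carrier_mat n m" "A' \<in> carrier_mat n m"
    and x: "\<And>k. x k \<in> carrier_vec m" "x' \<in> carrier_vec m"
    and tA: "\<And>i l. i < n \<Longrightarrow> l < m \<Longrightarrow> ((\<lambda>k. A k $$ (i, l)) \<longlongrightarrow> A' $$ (i, l)) F"
    and tx: "\<And>l. l < m \<Longrightarrow> ((\<lambda>k. x k $ l) \<longlongrightarrow> x' $ l) F"
    and i: "i < n"
  shows "((\<lambda>k. (A k *\<^sub>v x k) $ i) \<longlongrightarrow> (A' *\<^sub>v x') $ i) F"
proof -
  have "((\<lambda>k. \<Sum>l<m. A k $$ (i, l) * x k $ l) \<longlongrightarrow> (\<Sum>l<m. A' $$ (i, l) * x' $ l)) F"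
    using i by (intro tendsto_intros tA tx) auto
  moreover have "(A k *\<^sub>v x k) $ i = (\<Sum>l<m. A k $$ (i, l) * x k $ l)" for k
    using A(1)[of k] x(1)[of k] i by (simp add: mult_mat_vec_index del: index_mult_mat_vec)
  moreover have "(A' *\<^sub>v x') $ i = (\<Sum>l<m. A' $$ (i, l) * x' $ l)"
    using A(2) x(2) i by (simp add: mult_mat_vec_index del: index_mult_mat_vec)
  ultimately show ?thesis by simp
qed

lemma mat_analytic_atI:
  assumes h: "\<And>a b. a < n \<Longrightarrow> b < n \<Longrightarrow> (\<lambda>w. A w $$ (a, b)) holomorphic_on S" and S: "open S" "z \<in> S"
  shows "mat_analytic_at n A z"
  unfolding mat_analytic_at_def
  using analytic_on_subset[OF analytic_on_open[OF S(1), THEN iffD2, OF h]] S(2) by blast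

lemma mat_meromorphic_onI:
  assumes h: "\<And>a b. a < n \<Longrightarrow> b < n \<Longrightarrow> (\<lambda>w. A w $$ (a, b)) holomorphic_on S" and S: "open S"
    and "\<And>z. z \<in> S \<Longrightarrow> A z \<in> carrier_mat n n"
  shows "mat_meromorphic_on n A S"
  unfolding mat_meromorphic_on_def
  using assms analytic_on_imp_meromorphic_on analytic_on_open[OF S] by blast

text \<open>Singularities of a meromorphic function do not accumulate at a point of
  \<open>S\<close>, and there are finitely many entries. The point \<open>z\<close> itself may be a
  pole.\<close>

lemma mat_meromorphic_eventually_analytic:
  assumes m: "mat_meromorphic_on n A S" and z: "z \<in> S"
  shows "eventually (mat_analytic_at n A) (at z)"
proof -
  have "eventually (\<lambda>w. (\<lambda>w. A w $$ (a, b)) analytic_on {w}) (at z)" if "a < n" "b < n" for a b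
    using meromorphic_on_imp_not_islimpt_singularities[of "\<lambda>w. A w $$ (a, b)" S z] m z that
    by (auto simp: mat_meromorphic_on_def islimpt_conv_frequently_at frequently_def)
  hence "eventually (\<lambda>w. \<forall>a\<in>{..<n}. \<forall>b\<in>{..<n}. (\<lambda>w. A w $$ (a, b)) analytic_on {w}) (at z)"
    by (auto intro!: eventually_ball_finite)
  thus ?thesis by eventually_elim (auto simp: mat_analytic_at_def)
qed

section \<open>The matrices \<open>j\<close>, \<open>J\<close>, \<open>K\<close> and block fractions\<close>

lemma Kmat_carrier [simp]: "Kmat p \<in> carrier_mat (2*p) (2*p)"
  and jmat_carrier [simp]: "jmat p \<in> carrier_mat (2*p) (2*p)"
  and Jmat_carrier [simp]: "Jmat p \<in> carrier_mat (2*p) (2*p)"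
  unfolding Kmat_def jmat_def Jmat_def mult_2 by auto

lemma append_carrier_double [simp]:
  "x \<in> carrier_vec p \<Longrightarrow> y \<in> carrier_vec p \<Longrightarrow> x @\<^sub>v y \<in> carrier_vec (2 * p)"
  unfolding mult_2 by simp

lemma carrier_vec_doubleE:
  assumes "v \<in> carrier_vec (2 * p)"
  obtains x y where "x \<in> carrier_vec p" "y \<in> carrier_vec p" "v = x @\<^sub>v y"
proof (rule that)
  show "v = vec_first v p @\<^sub>v vec_last v p"
    using vec_first_last_append[of v p p] assms unfolding mult_2 by metis
qed simp_all

lemma jmat_mult_append:
  assumes "x \<in> carrier_vec p" "y \<in> carrier_vec p"
  shows "jmat p *\<^sub>v (x @\<^sub>v y) = x @\<^sub>v (- y)"
  unfolding jmat_def using assms by (subst mult_mat_vec_split) auto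

lemma Kmat_mult_append:
  assumes x: "x \<in> carrier_vec p" and y: "y \<in> carrier_vec p"
  shows "Kmat p *\<^sub>v (x @\<^sub>v y) =
    complex_of_real (1 / sqrt 2) \<cdot>\<^sub>v (x - y) @\<^sub>v complex_of_real (1 / sqrt 2) \<cdot>\<^sub>v (x + y)"
proof -
  have "Kmat p *\<^sub>v (x @\<^sub>v y) = complex_of_real (1 / sqrt 2) \<cdot>\<^sub>v
    (four_block_mat (1\<^sub>m p) (- 1\<^sub>m p) (1\<^sub>m p) (1\<^sub>m p) *\<^sub>v (x @\<^sub>v y))"
    unfolding Kmat_def using x y by (intro eq_vecI) auto
  also have "four_block_mat (1\<^sub>m p) (- 1\<^sub>m p) (1\<^sub>m p) (1\<^sub>m p) *\<^sub>v (x @\<^sub>v y) = (x - y) @\<^sub>v (x + y)"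
    using x y by (subst four_block_mat_mult_vec[of _ p p _ p _ p]) (auto simp: minus_add_uminus_vec[of x p y])
  also have "complex_of_real (1 / sqrt 2) \<cdot>\<^sub>v ((x - y) @\<^sub>v (x + y)) =
    complex_of_real (1 / sqrt 2) \<cdot>\<^sub>v (x - y) @\<^sub>v complex_of_real (1 / sqrt 2) \<cdot>\<^sub>v (x + y)"
    by (intro eq_vecI) auto
  finally show ?thesis .
qed

lemma mat_adjoint_Kmat: "mat_adjoint (Kmat p) = complex_of_real (1 / sqrt 2) \<cdot>\<^sub>m
     four_block_mat (1\<^sub>m p) (1\<^sub>m p) (- 1\<^sub>m p) (1\<^sub>m p)"
  by (intro eq_matI) (auto simp: Kmat_def)

lemma adjoint_Kmat_mult_append:
  assumes x: "x \<in> carrier_vec p" and y: "y \<in> carrier_vec p"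
  shows "mat_adjoint (Kmat p) *\<^sub>v (x @\<^sub>v y) =
    complex_of_real (1 / sqrt 2) \<cdot>\<^sub>v (x + y) @\<^sub>v complex_of_real (1 / sqrt 2) \<cdot>\<^sub>v (y - x)"
proof -
  have "mat_adjoint (Kmat p) *\<^sub>v (x @\<^sub>v y) = complex_of_real (1 / sqrt 2) \<cdot>\<^sub>v
    (four_block_mat (1\<^sub>m p) (1\<^sub>m p) (- 1\<^sub>m p) (1\<^sub>m p) *\<^sub>v (x @\<^sub>v y))"
    unfolding mat_adjoint_Kmat using x y by (intro eq_vecI) auto
  also have "four_block_mat (1\<^sub>m p) (1\<^sub>m p) (- 1\<^sub>m p) (1\<^sub>m p) *\<^sub>v (x @\<^sub>v y) = (x + y) @\<^sub>v (y - x)"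
    using x y by (subst four_block_mat_mult_vec[of _ p p _ p _ p]) (auto simp: minus_add_uminus_vec[of y p x] comm_add_vec[of _ p])
  also have "complex_of_real (1 / sqrt 2) \<cdot>\<^sub>v ((x + y) @\<^sub>v (y - x)) =
    complex_of_real (1 / sqrt 2) \<cdot>\<^sub>v (x + y) @\<^sub>v complex_of_real (1 / sqrt 2) \<cdot>\<^sub>v (y - x)"
    by (intro eq_vecI) auto
  finally show ?thesis .
qed

lemma Jmat_mult_append:
  assumes "x \<in> carrier_vec p" "y \<in> carrier_vec p"
  shows "Jmat p *\<^sub>v (x @\<^sub>v y) = y @\<^sub>v x"
  unfolding Jmat_def using assms by (subst four_block_mat_mult_vec[of _ p p _ p _ p]) auto

lemma ip_jmat:
  assumes "u \<in> carrier_vec (2*p)" "v \<in> carrier_vec (2*p)"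
  shows "ip u (jmat p *\<^sub>v v) = ip (jmat p *\<^sub>v u) v"
proof -
  obtain a b where u: "a \<in> carrier_vec p" "b \<in> carrier_vec p" "u = a @\<^sub>v b"
    using assms(1) by (rule carrier_vec_doubleE)
  obtain c d where v: "c \<in> carrier_vec p" "d \<in> carrier_vec p" "v = c @\<^sub>v d"
    using assms(2) by (rule carrier_vec_doubleE)
  have "ip b (- d) = ip (- b) d" using u v by (simp add: ip_def)
  thus ?thesis using u v by (simp add: jmat_mult_append ip_append[of _ p _ p])
qed

lemma jmat_jmat:
  assumes "v \<in> carrier_vec (2*p)"
  shows "jmat p *\<^sub>v (jmat p *\<^sub>v v) = v"
proof -
  obtain c d where v: "c \<in> carrier_vec p" "d \<in> carrier_vec p" "v = c @\<^sub>v d"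
    using assms by (rule carrier_vec_doubleE)
  thus ?thesis by (simp add: jmat_mult_append)
qed

lemma jmat_mult_carrier [simp]: "v \<in> carrier_vec (2*p) \<Longrightarrow> jmat p *\<^sub>v v \<in> carrier_vec (2*p)"
  using mult_mat_vec_carrier[OF jmat_carrier] .

lemma adjoint_Kmat_mult_carrier [simp]:
  "v \<in> carrier_vec (2*p) \<Longrightarrow> mat_adjoint (Kmat p) *\<^sub>v v \<in> carrier_vec (2*p)"
  using mult_mat_vec_carrier[OF mat_adjoint_carrier[OF Kmat_carrier]] .

lemma nsq_jmat:
  assumes "v \<in> carrier_vec (2*p)"
  shows "nsq (jmat p *\<^sub>v v) = nsq v"
  using assms by (simp add: ip_jmat jmat_jmat)

text \<open>The common computation behind the unitarity of \<open>Kmat p\<close> and the identity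
  that carries \<open>j\<close> to \<open>J\<close>.\<close>

lemma half_sqrt_double:
  assumes "x \<in> carrier_vec p" "y \<in> carrier_vec p"
  shows "complex_of_real (1 / sqrt 2) \<cdot>\<^sub>v (complex_of_real (1 / sqrt 2) \<cdot>\<^sub>v (x + y) + complex_of_real (1 / sqrt 2) \<cdot>\<^sub>v (x - y)) = x"
    "complex_of_real (1 / sqrt 2) \<cdot>\<^sub>v (complex_of_real (1 / sqrt 2) \<cdot>\<^sub>v (x + y) - complex_of_real (1 / sqrt 2) \<cdot>\<^sub>v (x - y)) = y"
proof -
  have s: "complex_of_real (1 / sqrt 2) * complex_of_real (1 / sqrt 2) = 1 / 2"
    by (simp flip: of_real_mult)
  have e: "complex_of_real (1 / sqrt 2) * (complex_of_real (1 / sqrt 2) * a + complex_of_real (1 / sqrt 2) * b) = (a + b) / 2"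
    "complex_of_real (1 / sqrt 2) * (complex_of_real (1 / sqrt 2) * a - complex_of_real (1 / sqrt 2) * b) = (a - b) / 2" for a b
    unfolding distrib_left right_diff_distrib mult.assoc[symmetric] s by (simp_all add: field_simps)
  show "complex_of_real (1 / sqrt 2) \<cdot>\<^sub>v (complex_of_real (1 / sqrt 2) \<cdot>\<^sub>v (x + y) + complex_of_real (1 / sqrt 2) \<cdot>\<^sub>v (x - y)) = x"
    "complex_of_real (1 / sqrt 2) \<cdot>\<^sub>v (complex_of_real (1 / sqrt 2) \<cdot>\<^sub>v (x + y) - complex_of_real (1 / sqrt 2) \<cdot>\<^sub>v (x - y)) = y"
    using assms by (intro eq_vecI; simp add: e del: of_real_divide)+
qed

lemma Kmat_adjoint_Kmat:
  assumes "v \<in> carrier_vec (2*p)"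
  shows "Kmat p *\<^sub>v (mat_adjoint (Kmat p) *\<^sub>v v) = v"
proof -
  obtain x y where v: "x \<in> carrier_vec p" "y \<in> carrier_vec p" "v = x @\<^sub>v y"
    using assms by (rule carrier_vec_doubleE)
  let ?s = "complex_of_real (1 / sqrt 2)"
  have "?s \<cdot>\<^sub>v (x + y) - ?s \<cdot>\<^sub>v (y - x) = ?s \<cdot>\<^sub>v (x + y) + ?s \<cdot>\<^sub>v (x - y)"
    "?s \<cdot>\<^sub>v (x + y) + ?s \<cdot>\<^sub>v (y - x) = ?s \<cdot>\<^sub>v (x + y) - ?s \<cdot>\<^sub>v (x - y)"
    using v by (auto simp: algebra_simps simp del: of_real_divide intro!: eq_vecI)
  thus ?thesis using v half_sqrt_double[of x p y]
    by (simp add: adjoint_Kmat_mult_append Kmat_mult_append del: of_real_divide)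
qed

lemma adjoint_Kmat_Kmat:
  assumes "v \<in> carrier_vec (2*p)"
  shows "mat_adjoint (Kmat p) *\<^sub>v (Kmat p *\<^sub>v v) = v"
proof -
  obtain x y where v: "x \<in> carrier_vec p" "y \<in> carrier_vec p" "v = x @\<^sub>v y"
    using assms by (rule carrier_vec_doubleE)
  let ?s = "complex_of_real (1 / sqrt 2)"
  have "?s \<cdot>\<^sub>v (x - y) + ?s \<cdot>\<^sub>v (x + y) = ?s \<cdot>\<^sub>v (x + y) + ?s \<cdot>\<^sub>v (x - y)"
    using v by (intro comm_add_vec[of _ p]) auto
  thus ?thesis using v half_sqrt_double[of x p y]
    by (simp add: adjoint_Kmat_mult_append Kmat_mult_append del: of_real_divide)
qed

text \<open>Conjugation by \<open>Kmat p\<close> carries \<open>j\<close> to \<open>J\<close>. This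
  turns the normalisation of \<beta>, stated with \<open>J\<close>, into one stated with
  \<open>j\<close>.\<close>

lemma Kmat_jmat_adjoint_Kmat:
  assumes "v \<in> carrier_vec (2*p)"
  shows "Kmat p *\<^sub>v (jmat p *\<^sub>v (mat_adjoint (Kmat p) *\<^sub>v v)) = Jmat p *\<^sub>v v"
proof -
  obtain x y where v: "x \<in> carrier_vec p" "y \<in> carrier_vec p" "v = x @\<^sub>v y"
    using assms by (rule carrier_vec_doubleE)
  let ?s = "complex_of_real (1 / sqrt 2)"
  have "- (?s \<cdot>\<^sub>v (y - x)) = ?s \<cdot>\<^sub>v (x - y)"
    using v by (auto simp: algebra_simps simp del: of_real_divide intro!: eq_vecI)
  thus ?thesis using v half_sqrt_double[of x p y]
    by (simp add: adjoint_Kmat_mult_append Kmat_mult_append jmat_mult_append Jmat_mult_append del: of_real_divide)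
qed

text \<open>In rotated coordinates \<open>j\<close> becomes \<open>J\<close>, which pairs the two
  halves. A vector with a zero half is therefore \<open>j\<close>-neutral, and for
  \<open>g = - \<i> \<phi> f\<close> the sign of the form is that of the imaginary part of
  \<open>ip f (\<phi> f)\<close>.\<close>

lemma j_form_adjoint_Kmat:
  assumes f: "f \<in> carrier_vec p" and g: "g \<in> carrier_vec p"
  defines "u \<equiv> mat_adjoint (Kmat p) *\<^sub>v (f @\<^sub>v g)"
  shows "Re (ip u (jmat p *\<^sub>v u)) = 2 * Re (ip f g)"
proof -
  have "ip u (jmat p *\<^sub>v u) = ip (f @\<^sub>v g) (Kmat p *\<^sub>v (jmat p *\<^sub>v u))"
    unfolding u_def using f g by (simp add: ip_mat_adjoint[of "Kmat p" "2*p" "2*p"])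
  also have "\<dots> = ip f g + ip g f"
    unfolding u_def using f g by (simp add: Kmat_jmat_adjoint_Kmat Jmat_mult_append ip_append[of _ p _ p])
  finally show ?thesis using f g Re_ip_commute[of f g] by simp
qed

lemma nsq_adjoint_Kmat:
  assumes f: "f \<in> carrier_vec p" and g: "g \<in> carrier_vec p"
  shows "nsq (mat_adjoint (Kmat p) *\<^sub>v (f @\<^sub>v g)) = nsq f + nsq g"
proof -
  have "ip (mat_adjoint (Kmat p) *\<^sub>v (f @\<^sub>v g)) (mat_adjoint (Kmat p) *\<^sub>v (f @\<^sub>v g)) =
    ip (f @\<^sub>v g) (Kmat p *\<^sub>v (mat_adjoint (Kmat p) *\<^sub>v (f @\<^sub>v g)))"
    using f g by (simp add: ip_mat_adjoint[of "Kmat p" "2*p" "2*p"])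
  thus ?thesis using f g by (simp add: Kmat_adjoint_Kmat ip_append[of _ p _ p])
qed

lemma mat_adjoint_jmat: "mat_adjoint (jmat p) = jmat p"
  by (intro eq_matI) (auto simp: jmat_def)

section \<open>Blocks of a square matrix of size 2p and matrix fractions\<close>

abbreviation blk11 :: "nat \<Rightarrow> complex mat \<Rightarrow> complex mat" where
  "blk11 p M \<equiv> fst (split_block M p p)"
abbreviation blk12 :: "nat \<Rightarrow> complex mat \<Rightarrow> complex mat" where
  "blk12 p M \<equiv> fst (snd (split_block M p p))"
abbreviation blk21 :: "nat \<Rightarrow> complex mat \<Rightarrow> complex mat" where
  "blk21 p M \<equiv> fst (snd (snd (split_block M p p)))"
abbreviation blk22 :: "nat \<Rightarrow> complex mat \<Rightarrow> complex mat" where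
  "blk22 p M \<equiv> snd (snd (snd (split_block M p p)))"

lemma blk_carrier:
  assumes "M \<in> carrier_mat (2*p) (2*p)"
  shows "blk11 p M \<in> carrier_mat p p" "blk12 p M \<in> carrier_mat p p"
    "blk21 p M \<in> carrier_mat p p" "blk22 p M \<in> carrier_mat p p"
  using assms by (auto simp: split_block_def Let_def)

lemma blk_four_block:
  assumes "M \<in> carrier_mat (2*p) (2*p)"
  shows "M = four_block_mat (blk11 p M) (blk12 p M) (blk21 p M) (blk22 p M)"
  using assms by (intro split_block(5)[of M p p _ _ _ _ p p]) auto

lemma blk_mult_append:
  assumes M: "M \<in> carrier_mat (2*p) (2*p)" and x: "x \<in> carrier_vec p" and y: "y \<in> carrier_vec p"
  shows "M *\<^sub>v (x @\<^sub>v y) = (blk11 p M *\<^sub>v x + blk12 p M *\<^sub>v y) @\<^sub>v (blk21 p M *\<^sub>v x + blk22 p M *\<^sub>v y)"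
  by (subst blk_four_block[OF M], rule four_block_mat_mult_vec[OF blk_carrier[OF M] x y])

text \<open>Denominator, and with \<open>bot_fac\<close> the numerator, of the linear fractional map
  with coefficient matrix \<open>M\<close> at the pair \<open>(R, Q)\<close>.\<close>

definition top_fac :: "nat \<Rightarrow> complex mat \<Rightarrow> complex mat \<Rightarrow> complex mat \<Rightarrow> complex mat" where
  "top_fac p M R Q = blk11 p M * R + blk12 p M * Q"

definition bot_fac :: "nat \<Rightarrow> complex mat \<Rightarrow> complex mat \<Rightarrow> complex mat \<Rightarrow> complex mat" where
  "bot_fac p M R Q = blk21 p M * R + blk22 p M * Q"

lemma fac_carrier:
  assumes M: "M \<in> carrier_mat (2*p) (2*p)" and RQ: "R \<in> carrier_mat p p" "Q \<in> carrier_mat p p"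
  shows "top_fac p M R Q \<in> carrier_mat p p" "bot_fac p M R Q \<in> carrier_mat p p"
  unfolding top_fac_def bot_fac_def
  using mult_carrier_mat[OF blk_carrier(2)[OF M] RQ(2)] mult_carrier_mat[OF blk_carrier(4)[OF M] RQ(2)]
  by auto

lemma fac_mult:
  assumes M: "M \<in> carrier_mat (2*p) (2*p)" and RQ: "R \<in> carrier_mat p p" "Q \<in> carrier_mat p p"
    and y: "y \<in> carrier_vec p"
  shows "M *\<^sub>v ((R *\<^sub>v y) @\<^sub>v (Q *\<^sub>v y)) = (top_fac p M R Q *\<^sub>v y) @\<^sub>v (bot_fac p M R Q *\<^sub>v y)"
proof -
  note B = blk_carrier[OF M]
  have "top_fac p M R Q *\<^sub>v y = blk11 p M *\<^sub>v (R *\<^sub>v y) + blk12 p M *\<^sub>v (Q *\<^sub>v y)"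
    unfolding top_fac_def
    by (simp add: add_mult_distrib_mat_vec[OF mult_carrier_mat[OF B(1) RQ(1)] mult_carrier_mat[OF B(2) RQ(2)] y]
        assoc_mult_mat_vec[OF B(1) RQ(1) y] assoc_mult_mat_vec[OF B(2) RQ(2) y])
  moreover have "bot_fac p M R Q *\<^sub>v y = blk21 p M *\<^sub>v (R *\<^sub>v y) + blk22 p M *\<^sub>v (Q *\<^sub>v y)"
    unfolding bot_fac_def
    by (simp add: add_mult_distrib_mat_vec[OF mult_carrier_mat[OF B(3) RQ(1)] mult_carrier_mat[OF B(4) RQ(2)] y]
        assoc_mult_mat_vec[OF B(3) RQ(1) y] assoc_mult_mat_vec[OF B(4) RQ(2) y])
  ultimately show ?thesis
    using blk_mult_append[OF M mult_mat_vec_carrier[OF RQ(1) y] mult_mat_vec_carrier[OF RQ(2) y]] by simp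
qed

section \<open>The forms \<open>j\<close> and \<open>j C j\<close>\<close>

text \<open>Unrolls the recursion from index 0 upwards. It is meant for \<open>a\<close> the
  \<open>j\<close>-forms along a chain and \<open>g\<close> the forms of
  \<open>j C j\<close>.\<close>

lemma sum_of_backward_recursion:
  fixes a g :: "nat \<Rightarrow> real"
  assumes "\<And>k. k < n \<Longrightarrow> a k = q * a (Suc k) - 2 * r * g k"
  shows "a 0 = q ^ n * a n - 2 * r * (\<Sum>k<n. q ^ k * g k)"
  using assms
proof (induction n)
  case (Suc n)
  have "a 0 = q ^ n * a n - 2 * r * (\<Sum>k<n. q ^ k * g k)" using Suc by simp
  also have "a n = q * a (Suc n) - 2 * r * g n" using Suc.prems by simp
  finally show ?case by (simp add: algebra_simps)
qed simp

lemma lower_halfD: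
  assumes "z \<in> lower_half"
  shows "z \<noteq> 0" "Im z < 0"
  using assms by (auto simp: lower_half_def)

lemma open_lower_half: "open lower_half"
  unfolding lower_half_def by (rule open_halfspace_Im_lt)

lemma sq_le_divide_Suc_less:
  fixes x R e :: real
  assumes "x\<^sup>2 \<le> R / Suc n" "R / e\<^sup>2 < Suc n" "e > 0"
  shows "x < e"
proof -
  have "R / Suc n < e\<^sup>2" using assms(2,3) by (simp add: field_simps)
  hence "x\<^sup>2 < e\<^sup>2" using assms(1) by linarith
  thus ?thesis using assms(3) by (simp add: power2_less_imp_less)
qed

section \<open>The coefficient matrices of the system\<close>

locale discrete_dirac =
  fixes p :: nat and \<beta> :: "nat \<Rightarrow> complex mat"
  assumes \<beta>_carrier [simp]: "\<And>k. \<beta> k \<in> carrier_mat p (2 * p)"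
    and \<beta>_J: "\<And>k. \<beta> k * Jmat p * mat_adjoint (\<beta> k) = 1\<^sub>m p"
begin

abbreviation jop :: "complex vec \<Rightarrow> complex vec" where "jop v \<equiv> jmat p *\<^sub>v v"

text \<open>Absorbing \<open>Kmat p\<close> leaves the data of the system in the form
  \<open>C = 2 b\<^sup>* b - j\<close> with \<open>b j b\<^sup>* = 1\<close>.\<close>

definition bK :: "nat \<Rightarrow> complex mat" where "bK k = \<beta> k * Kmat p"

abbreviation C :: "nat \<Rightarrow> complex mat" where "C \<equiv> Cmat p \<beta>"

lemma b_carrier [simp]: "bK k \<in> carrier_mat p (2*p)"
  unfolding bK_def by (rule mult_carrier_mat[OF \<beta>_carrier Kmat_carrier])

lemma b_mult_carrier [simp]: "v \<in> carrier_vec (2*p) \<Longrightarrow> bK k *\<^sub>v v \<in> carrier_vec p"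
  using mult_mat_vec_carrier[OF b_carrier] .

lemma b_adjoint_mult_carrier [simp]: "v \<in> carrier_vec p \<Longrightarrow> mat_adjoint (bK k) *\<^sub>v v \<in> carrier_vec (2*p)"
  using mult_mat_vec_carrier[OF mat_adjoint_carrier[OF b_carrier]] .

text \<open>The hypothesis on \<beta> with \<open>J\<close> replaced by its expression through
  \<open>Kmat p\<close> and \<open>j\<close>. Thus the adjoint of \<open>bK k\<close> is isometric
  from the standard form to the \<open>j\<close>-form.\<close>

lemma b_j_adjoint_b:
  assumes x: "x \<in> carrier_vec p"
  shows "bK k *\<^sub>v jop (mat_adjoint (bK k) *\<^sub>v x) = x"
proof -
  define y where "y = mat_adjoint (\<beta> k) *\<^sub>v x"
  have y: "y \<in> carrier_vec (2*p)"
    unfolding y_def by (rule mult_mat_vec_carrier[OF mat_adjoint_carrier[OF \<beta>_carrier] x])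
  have "mat_adjoint (bK k) *\<^sub>v x = mat_adjoint (Kmat p) *\<^sub>v y"
    unfolding bK_def y_def mat_adjoint_mult[OF \<beta>_carrier Kmat_carrier]
    by (rule assoc_mult_mat_vec[OF mat_adjoint_carrier[OF Kmat_carrier] mat_adjoint_carrier[OF \<beta>_carrier] x])
  hence "bK k *\<^sub>v jop (mat_adjoint (bK k) *\<^sub>v x) = \<beta> k *\<^sub>v (Kmat p *\<^sub>v jop (mat_adjoint (Kmat p) *\<^sub>v y))"
    unfolding bK_def using y by (simp add: assoc_mult_mat_vec[OF \<beta>_carrier Kmat_carrier])
  also have "\<dots> = \<beta> k *\<^sub>v (Jmat p *\<^sub>v y)" using y by (simp add: Kmat_jmat_adjoint_Kmat)
  also have "\<dots> = (\<beta> k * Jmat p) *\<^sub>v y"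
    by (rule assoc_mult_mat_vec[OF \<beta>_carrier Jmat_carrier y, symmetric])
  also have "\<dots> = (\<beta> k * Jmat p * mat_adjoint (\<beta> k)) *\<^sub>v x"
    unfolding y_def
    by (rule assoc_mult_mat_vec[OF mult_carrier_mat[OF \<beta>_carrier Jmat_carrier] mat_adjoint_carrier[OF \<beta>_carrier] x, symmetric])
  also have "\<dots> = x" using x by (simp add: \<beta>_J)
  finally show ?thesis .
qed

lemma Cmat_eq: "C k = 2 \<cdot>\<^sub>m (mat_adjoint (bK k) * bK k) - jmat p"
proof -
  let ?K = "Kmat p"
  note K = Kmat_carrier[of p] and Ka = mat_adjoint_carrier[OF Kmat_carrier[of p]]
    and ba = mat_adjoint_carrier[OF \<beta>_carrier[of k]]
  have "mat_adjoint ?K * mat_adjoint (\<beta> k) * \<beta> k * ?K = mat_adjoint ?K * mat_adjoint (\<beta> k) * (\<beta> k * ?K)"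
    by (rule assoc_mult_mat[OF mult_carrier_mat[OF Ka ba] \<beta>_carrier K])
  thus ?thesis unfolding Cmat_def bK_def mat_adjoint_mult[OF \<beta>_carrier K] by simp
qed

lemma C_carrier [simp]: "C k \<in> carrier_mat (2*p) (2*p)"
  unfolding Cmat_eq
  by (intro minus_carrier_mat jmat_carrier)

lemma C_mult_carrier [simp]: "v \<in> carrier_vec (2*p) \<Longrightarrow> C k *\<^sub>v v \<in> carrier_vec (2*p)"
  using mult_mat_vec_carrier[OF C_carrier] .

lemma C_mult:
  assumes v: "v \<in> carrier_vec (2*p)"
  shows "C k *\<^sub>v v = 2 \<cdot>\<^sub>v (mat_adjoint (bK k) *\<^sub>v (bK k *\<^sub>v v)) - jop v"
proof -
  note ba = mat_adjoint_carrier[OF b_carrier[of k]]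
  have P: "mat_adjoint (bK k) * bK k \<in> carrier_mat (2*p) (2*p)"
    by (rule mult_carrier_mat[OF ba b_carrier])
  have "C k *\<^sub>v v = (2 \<cdot>\<^sub>m (mat_adjoint (bK k) * bK k)) *\<^sub>v v - jop v"
    unfolding Cmat_eq by (rule minus_mult_distrib_mat_vec[OF smult_carrier_mat[OF P] jmat_carrier v])
  also have "(2 \<cdot>\<^sub>m (mat_adjoint (bK k) * bK k)) *\<^sub>v v = 2 \<cdot>\<^sub>v ((mat_adjoint (bK k) * bK k) *\<^sub>v v)"
    using P v by (intro eq_vecI) auto
  also have "(mat_adjoint (bK k) * bK k) *\<^sub>v v = mat_adjoint (bK k) *\<^sub>v (bK k *\<^sub>v v)"
    by (rule assoc_mult_mat_vec[OF ba b_carrier v])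
  finally show ?thesis .
qed

lemma ip_b: "u \<in> carrier_vec p \<Longrightarrow> v \<in> carrier_vec (2*p) \<Longrightarrow>
    ip u (bK k *\<^sub>v v) = ip (mat_adjoint (bK k) *\<^sub>v u) v"
  by (rule ip_mat_adjoint[OF b_carrier])

lemma ip_b_adjoint: "u \<in> carrier_vec (2*p) \<Longrightarrow> v \<in> carrier_vec p \<Longrightarrow>
    ip u (mat_adjoint (bK k) *\<^sub>v v) = ip (bK k *\<^sub>v u) v"
  using ip_mat_adjoint[OF mat_adjoint_carrier[OF b_carrier]] by simp

lemma ip_C:
  assumes u: "u \<in> carrier_vec (2*p)" and v: "v \<in> carrier_vec (2*p)"
  shows "ip u (C k *\<^sub>v v) = ip (C k *\<^sub>v u) v"
  using u v
  by (simp add: C_mult ip_diff_left[of _ "2*p"] ip_diff_right[of _ "2*p"] ip_smult_left[of _ "2*p"]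
      ip_smult_right ip_jmat ip_b_adjoint ip_b)

text \<open>Multiply out \<open>2 b\<^sup>* b - j\<close> with \<open>b j b\<^sup>* = 1\<close>: the
  terms in \<open>b\<^sup>* b\<close> have coefficients 4, -2, -2 and cancel. Consequently
  \<open>j C j\<close> inverts \<open>C\<close>.\<close>

lemma C_j_C:
  assumes v: "v \<in> carrier_vec (2*p)"
  shows "C k *\<^sub>v jop (C k *\<^sub>v v) = jop v"
proof -
  define y where "y = bK k *\<^sub>v v"
  have y: "y \<in> carrier_vec p" using v by (simp add: y_def)
  have Cv: "C k *\<^sub>v v = 2 \<cdot>\<^sub>v (mat_adjoint (bK k) *\<^sub>v y) - jop v"
    using v by (simp add: C_mult y_def)
  have jCv: "jop (C k *\<^sub>v v) = 2 \<cdot>\<^sub>v jop (mat_adjoint (bK k) *\<^sub>v y) - v"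
    unfolding Cv using v y
    by (simp add: mult_minus_distrib_mat_vec[OF jmat_carrier] mult_mat_vec[OF jmat_carrier] jmat_jmat)
  have "bK k *\<^sub>v jop (C k *\<^sub>v v) = 2 \<cdot>\<^sub>v y - y"
    unfolding jCv using v y
    by (simp add: mult_minus_distrib_mat_vec[OF b_carrier] mult_mat_vec[OF b_carrier] b_j_adjoint_b
        flip: y_def)
  also have "\<dots> = y" using y by (intro eq_vecI) auto
  finally have "C k *\<^sub>v jop (C k *\<^sub>v v) = 2 \<cdot>\<^sub>v (mat_adjoint (bK k) *\<^sub>v y) - C k *\<^sub>v v"
    using v by (simp add: C_mult[of "jop (C k *\<^sub>v v)"] jmat_jmat)
  also have "\<dots> = jop v" unfolding Cv
    using v y b_adjoint_mult_carrier[OF y, of k] jmat_mult_carrier[OF v]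
    by (intro eq_vecI) (auto simp del: index_mult_mat_vec)
  finally show ?thesis .
qed

text \<open>The kernel of \<open>bK k\<close> is the \<open>j\<close>-orthogonal complement of a maximal \<open>j\<close>-positive subspace.\<close>

lemma kernel_b_nonpos:
  assumes w: "w \<in> carrier_vec (2*p)" and bw: "bK k *\<^sub>v w = 0\<^sub>v p"
  shows "Re (ip w (jop w)) \<le> 0"
proof -
  \<comment> \<open>\<open>A\<close> and \<open>B\<close> are the upper and lower halves of the
    adjoint of \<open>bK k\<close>.\<close>
  define A where "A = mat p p (\<lambda>(i, l). mat_adjoint (bK k) $$ (i, l))"
  define B where "B = mat p p (\<lambda>(i, l). mat_adjoint (bK k) $$ (p + i, l))"
  have A: "A \<in> carrier_mat p p" and B: "B \<in> carrier_mat p p" by (auto simp: A_def B_def)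
  have split: "mat_adjoint (bK k) *\<^sub>v y = (A *\<^sub>v y) @\<^sub>v (B *\<^sub>v y)" if y: "y \<in> carrier_vec p" for y
    using y carrier_matD[OF b_carrier[of k]]
    by (intro eq_vecI) (auto simp: A_def B_def mult_mat_vec_index simp del: index_mult_mat_vec)
  have norm: "nsq y = nsq (A *\<^sub>v y) - nsq (B *\<^sub>v y)" if y: "y \<in> carrier_vec p" for y
  proof -
    have Ay: "A *\<^sub>v y \<in> carrier_vec p" "B *\<^sub>v y \<in> carrier_vec p"
      using mult_mat_vec_carrier[OF A y] mult_mat_vec_carrier[OF B y] by auto
    have "ip y y = ip y (bK k *\<^sub>v jop (mat_adjoint (bK k) *\<^sub>v y))" using y by (simp add: b_j_adjoint_b)
    also have "\<dots> = ip (mat_adjoint (bK k) *\<^sub>v y) (jop (mat_adjoint (bK k) *\<^sub>v y))"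
      using y by (intro ip_b) auto
    also have "\<dots> = ip (A *\<^sub>v y) (A *\<^sub>v y) + ip (B *\<^sub>v y) (- (B *\<^sub>v y))"
      unfolding split[OF y] jmat_mult_append[OF Ay] using Ay by (subst ip_append[of _ p _ p]) auto
    also have "ip (B *\<^sub>v y) (- (B *\<^sub>v y)) = - ip (B *\<^sub>v y) (B *\<^sub>v y)"
      by (simp add: ip_def sum_negf)
    finally show ?thesis by simp
  qed
  \<comment> \<open>By \<open>norm\<close>, \<open>nsq y\<close> is at most
    \<open>nsq (A y)\<close>, so \<open>A\<close> is injective.\<close>
  have "det A \<noteq> 0"
  proof
    assume "det A = 0"
    then obtain y where y: "y \<in> carrier_vec p" "y \<noteq> 0\<^sub>v p" "A *\<^sub>v y = 0\<^sub>v p"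
      using det_0_iff_vec_prod_zero_field[OF A] by blast
    have "nsq y \<le> 0" using norm[OF y(1)] y(3) nsq_nonneg[of "B *\<^sub>v y"] by (simp add: ip_def)
    thus False using nsq_nonneg[of y] nsq_eq_0_iff[OF y(1)] y(2) by simp
  qed
  obtain w1 w2 where w12: "w1 \<in> carrier_vec p" "w2 \<in> carrier_vec p" "w = w1 @\<^sub>v w2"
    using w by (rule carrier_vec_doubleE)
  \<comment> \<open>Choose the element of the positive subspace whose upper half is that of
    \<open>w\<close>. Its pairing with \<open>w\<close> vanishes and its lower half is no longer
    than \<open>w1\<close>, which forces \<open>w1\<close> to be no longer than
    \<open>w2\<close>.\<close>
  obtain y where y: "y \<in> carrier_vec p" "A *\<^sub>v y = w1"
    using mult_mat_vec_surj[OF A \<open>det A \<noteq> 0\<close> w12(1)] by blast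
  have By: "B *\<^sub>v y \<in> carrier_vec p" using mult_mat_vec_carrier[OF B y(1)] .
  have "0 = ip y (bK k *\<^sub>v w)" unfolding bw by (simp add: ip_def)
  also have "\<dots> = ip (w1 @\<^sub>v (B *\<^sub>v y)) (w1 @\<^sub>v w2)"
    using y w w12 by (simp add: ip_b split)
  also have "\<dots> = ip w1 w1 + ip (B *\<^sub>v y) w2"
    using w12 By by (simp add: ip_append[of _ p _ p])
  finally have "nsq w1 + Re (ip (B *\<^sub>v y) w2) = 0"
    by (metis plus_complex.sel(1) zero_complex.sel(1))
  moreover have "- 2 * Re (ip (B *\<^sub>v y) w2) \<le> nsq (B *\<^sub>v y) + nsq w2"
    using am_gm_ip[OF By w12(2), of 1] by simp
  moreover have "nsq (B *\<^sub>v y) \<le> nsq w1" using norm[OF y(1)] nsq_nonneg[of y] y(2) by simp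
  ultimately have le: "nsq w1 \<le> nsq w2" by linarith
  have "ip w2 (- w2) = - ip w2 w2" by (simp add: ip_def sum_negf)
  hence "Re (ip w (jop w)) = nsq w1 - nsq w2"
    using w12 by (simp add: jmat_mult_append ip_append[of _ p _ p])
  thus ?thesis using le by simp
qed

text \<open>Split \<open>v = w + e\<close> with \<open>bK k w = 0\<close> and \<open>e\<close> the
  \<open>j\<close>-orthogonal projection onto the range of \<open>j b\<^sup>*\<close>. With
  \<open>x = b v\<close> the two forms of \<open>v\<close> are \<open>nsq x\<close> plus and minus
  the \<open>j\<close>-form of \<open>w\<close>, and the latter is nonpositive.\<close>

lemma C_ge_abs_j:
  assumes v: "v \<in> carrier_vec (2*p)"
  shows "\<bar>Re (ip v (jop v))\<bar> \<le> Re (ip v (C k *\<^sub>v v))"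
proof -
  define x where "x = bK k *\<^sub>v v"
  define e where "e = jop (mat_adjoint (bK k) *\<^sub>v x)"
  define w where "w = v - e"
  have x: "x \<in> carrier_vec p" using v by (simp add: x_def)
  have e: "e \<in> carrier_vec (2*p)" using x by (simp add: e_def)
  have w: "w \<in> carrier_vec (2*p)" using v e by (simp add: w_def)
  have je: "jop e = mat_adjoint (bK k) *\<^sub>v x" using x by (simp add: e_def jmat_jmat)
  have be: "bK k *\<^sub>v e = x" using x by (simp add: e_def b_j_adjoint_b)
  have bw: "bK k *\<^sub>v w = 0\<^sub>v p"
    using v e x by (simp add: w_def mult_minus_distrib_mat_vec[OF b_carrier] be flip: x_def)
  have vw: "v = w + e" using v e unfolding w_def by (intro eq_vecI) auto
  have we: "ip w (jop e) = 0"
    unfolding je ip_b_adjoint[OF w x] bw using x by (simp add: ip_def)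
  have ew: "ip e (jop w) = 0"
    using cnj_ip[of w "jop e"] we w e carrier_matD[OF jmat_carrier[of p]] by (simp add: ip_jmat)
  have ee: "ip e (jop e) = ip x x" using e x by (simp add: je ip_b_adjoint be)
  have "ip v (jop v) = ip w (jop w) + ip x x"
    unfolding vw using w e we ew ee
    by (simp add: mult_add_distrib_mat_vec[OF jmat_carrier] ip_add_left[of _ "2*p"] ip_add_right[of _ "2*p"])
  moreover have "ip v (C k *\<^sub>v v) = 2 * ip x x - ip v (jop v)"
    using v x by (simp add: C_mult ip_diff_right[of _ "2*p"] ip_smult_right ip_b_adjoint flip: x_def)
  moreover have "Re (ip w (jop w)) \<le> 0" using kernel_b_nonpos[OF w bw] .
  ultimately show ?thesis using nsq_nonneg[of x] by simp
qed

lemma C_nonneg: "v \<in> carrier_vec (2*p) \<Longrightarrow> 0 \<le> Re (ip v (C k *\<^sub>v v))"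
  using C_ge_abs_j[of v k] by linarith

text \<open>Here \<open>j C j\<close> is the inverse of \<open>C\<close>, so an upper bound for \<open>C\<close> is a lower bound as well.\<close>

lemma C_lower_bound: "\<exists>c>0. \<forall>v\<in>carrier_vec (2*p). c * nsq v \<le> Re (ip v (C k *\<^sub>v v))"
proof -
  obtain B where B: "B > 0" "\<And>v. v \<in> carrier_vec (2*p) \<Longrightarrow> Re (ip v (C k *\<^sub>v v)) \<le> B * nsq v"
    using quadratic_form_bound[OF C_carrier] by blast
  have "1 / B * nsq v \<le> Re (ip v (C k *\<^sub>v v))" if v: "v \<in> carrier_vec (2*p)" for v
  proof -
    define g where "g = jop (C k *\<^sub>v jop v)"
    \<comment> \<open>The nonnegative \<open>C\<close>-form of \<open>v + t g\<close>, where
      \<open>C g = v\<close>, is quadratic in \<open>t\<close>. At \<open>t = - 1 / B\<close> the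
      bound on \<open>ip g v\<close> eats half of the linear term and leaves
      \<open>nsq v / B\<close>.\<close>
    define t where "t = - 1 / B"
    have g: "g \<in> carrier_vec (2*p)" using v by (simp add: g_def)
    have Cg: "C k *\<^sub>v g = v" unfolding g_def using v by (simp add: C_j_C jmat_jmat)
    have gv: "ip g v = ip (jop v) (C k *\<^sub>v jop v)"
      unfolding g_def using v by (simp add: ip_C flip: ip_jmat)
    have gC: "ip g (C k *\<^sub>v v) = ip v v" using g v by (simp add: ip_C Cg)
    have "Re (ip g v) \<le> B * nsq v"
      unfolding gv using B(2)[of "jop v"] v by (simp add: nsq_jmat)
    hence "t\<^sup>2 * Re (ip g v) \<le> t\<^sup>2 * (B * nsq v)" by (rule mult_left_mono) simp
    also have "\<dots> = nsq v / B" using B(1) by (simp add: t_def power2_eq_square)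
    finally have 1: "t\<^sup>2 * Re (ip g v) \<le> nsq v / B" .
    let ?x = "v + complex_of_real t \<cdot>\<^sub>v g"
    have Cx: "C k *\<^sub>v ?x = C k *\<^sub>v v + complex_of_real t \<cdot>\<^sub>v v"
      using v g by (simp add: mult_add_distrib_mat_vec[OF C_carrier] mult_mat_vec[OF C_carrier] Cg)
    have "0 \<le> Re (ip ?x (C k *\<^sub>v ?x))" using v g by (intro C_nonneg) auto
    also have "\<dots> = Re (ip v (C k *\<^sub>v v)) + 2 * t * nsq v + t\<^sup>2 * Re (ip g v)"
      unfolding Cx using v g
      by (simp add: ip_add_left[of _ "2*p"] ip_add_right[of _ "2*p"] ip_smult_left[of _ "2*p"]
          ip_smult_right gC) (simp add: power2_eq_square algebra_simps)
    also have "2 * t * nsq v = - 2 * nsq v / B" by (simp add: t_def)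
    finally show ?thesis using 1 by simp
  qed
  thus ?thesis using B(1) by (intro exI[of _ "1 / B"]) simp
qed

text \<open>The form of \<open>j C j\<close>, that is, of the inverse of \<open>C\<close>.\<close>

definition gform :: "nat \<Rightarrow> complex vec \<Rightarrow> real" where
  "gform k v = Re (ip (jop v) (C k *\<^sub>v jop v))"

abbreviation jform :: "complex vec \<Rightarrow> real" where
  "jform v \<equiv> Re (ip v (jop v))"

lemma gform_ge_abs_jform: "v \<in> carrier_vec (2*p) \<Longrightarrow> \<bar>jform v\<bar> \<le> gform k v"
  using C_ge_abs_j[of "jop v" k] Re_ip_commute[of "jop v" v]
  by (simp add: gform_def jmat_jmat carrier_vecD[OF jmat_mult_carrier] del: dim_mult_mat_vec)

lemma gform_nonneg: "v \<in> carrier_vec (2*p) \<Longrightarrow> 0 \<le> gform k v"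
  using gform_ge_abs_jform[of v k] by linarith

lemma gform_lower_bound: "\<exists>c>0. \<forall>v\<in>carrier_vec (2*p). c * nsq v \<le> gform k v"
  using C_lower_bound[of k] unfolding gform_def by (metis jmat_mult_carrier nsq_jmat)

text \<open>The parallelogram law, with the form of the sum dropped as nonnegative.\<close>

lemma gform_diff_le:
  assumes u: "u \<in> carrier_vec (2*p)" and v: "v \<in> carrier_vec (2*p)"
  shows "gform k (u - v) \<le> 2 * gform k u + 2 * gform k v"
proof -
  have "gform k (u - v) + gform k (u + v) = 2 * gform k u + 2 * gform k v"
    using u v unfolding gform_def
    by (simp add: mult_add_distrib_mat_vec[OF jmat_carrier] mult_minus_distrib_mat_vec[OF jmat_carrier]
        mult_add_distrib_mat_vec[OF C_carrier] mult_minus_distrib_mat_vec[OF C_carrier]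
        ip_add_left[of _ "2*p"] ip_add_right[of _ "2*p"] ip_diff_left[of _ "2*p"] ip_diff_right[of _ "2*p"])
  thus ?thesis using gform_nonneg[of "u + v" k] u v by simp
qed

text \<open>The adjoint of the one-step matrix of the system taken at the conjugate of
  \<open>z\<close>.\<close>

definition T :: "nat \<Rightarrow> complex \<Rightarrow> complex mat" where
  "T k z = 1\<^sub>m (2*p) + (\<i> / z) \<cdot>\<^sub>m (C k * jmat p)"

lemma T_carrier [simp]: "T k z \<in> carrier_mat (2*p) (2*p)"
  unfolding T_def
  by (intro add_carrier_mat smult_carrier_mat mult_carrier_mat[OF C_carrier jmat_carrier])

lemma T_mult_carrier [simp]: "v \<in> carrier_vec (2*p) \<Longrightarrow> T k z *\<^sub>v v \<in> carrier_vec (2*p)"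
  using mult_mat_vec_carrier[OF T_carrier] .

lemma T_mult:
  assumes v: "v \<in> carrier_vec (2*p)"
  shows "T k z *\<^sub>v v = v + (\<i> / z) \<cdot>\<^sub>v (C k *\<^sub>v jop v)"
proof -
  note P = mult_carrier_mat[OF C_carrier[of k] jmat_carrier]
  have "T k z *\<^sub>v v = 1\<^sub>m (2*p) *\<^sub>v v + ((\<i> / z) \<cdot>\<^sub>m (C k * jmat p)) *\<^sub>v v"
    unfolding T_def by (rule add_mult_distrib_mat_vec[OF one_carrier_mat smult_carrier_mat[OF P] v])
  also have "((\<i> / z) \<cdot>\<^sub>m (C k * jmat p)) *\<^sub>v v = (\<i> / z) \<cdot>\<^sub>v ((C k * jmat p) *\<^sub>v v)"
    using P v by (intro eq_vecI) auto
  also have "(C k * jmat p) *\<^sub>v v = C k *\<^sub>v jop v"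
    by (rule assoc_mult_mat_vec[OF C_carrier jmat_carrier v])
  finally show ?thesis using v by simp
qed

text \<open>For \<open>a = \<i> / z\<close> these are \<open>1 + |a|\<^sup>2\<close> and \<open>- Re a\<close>.\<close>

definition qz :: "complex \<Rightarrow> real" where "qz z = 1 + 1 / (cmod z)\<^sup>2"
definition rz :: "complex \<Rightarrow> real" where "rz z = - Im z / (cmod z)\<^sup>2"

lemma Re_i_divide: "Re (\<i> / z) = - rz z"
  by (simp add: rz_def Re_divide cmod_power2)

lemma i_divide_cnj: "(\<i> / z) * cnj (\<i> / z) = complex_of_real (qz z - 1)"
  by (simp add: complex_norm_square qz_def norm_divide power_divide flip: complex_norm_square)

text \<open>With \<open>y = C j v\<close> also \<open>C j y = v\<close>, so all forms of
  \<open>T v = v + a y\<close> reduce to the two numbers \<gamma> and \<delta>. The pair of forms is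
  transformed by the symmetric 2 by 2 matrix with diagonal \<open>qz z\<close> and off-diagonal
  \<open>- 2 * rz z\<close>.\<close>

lemma T_forms:
  assumes v: "v \<in> carrier_vec (2*p)"
  shows jform_T: "jform (T k z *\<^sub>v v) = qz z * jform v - 2 * rz z * gform k v"
    and gform_T: "gform k (T k z *\<^sub>v v) = qz z * gform k v - 2 * rz z * jform v"
proof -
  define a where "a = \<i> / z"
  define y where "y = C k *\<^sub>v jop v"
  define \<gamma> where "\<gamma> = ip (jop v) y"
  define \<delta> where "\<delta> = ip v (jop v)"
  have y: "y \<in> carrier_vec (2*p)" using v by (simp add: y_def)
  have Cjy: "C k *\<^sub>v jop y = v" using v by (simp add: y_def C_j_C jmat_jmat)
  have yj: "ip y (jop y) = \<delta>"
  proof -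
    have "ip y (jop y) = ip (jop v) (C k *\<^sub>v jop y)" unfolding y_def using v by (simp add: ip_C)
    thus ?thesis using v by (simp add: Cjy \<delta>_def ip_jmat)
  qed
  have vy: "ip v (jop y) = \<gamma>" using v y by (simp add: \<gamma>_def ip_jmat)
  have yv: "ip y (jop v) = cnj \<gamma>" unfolding \<gamma>_def using v y
    by (intro cnj_ip[symmetric]) (metis carrier_vecD jmat_mult_carrier)
  have aa: "Re a = - rz z" unfolding a_def by (rule Re_i_divide)
  have a2: "a * cnj a = complex_of_real (qz z - 1)" unfolding a_def by (rule i_divide_cnj)
  have Tv: "T k z *\<^sub>v v = v + a \<cdot>\<^sub>v y" using v by (simp add: T_mult a_def y_def)
  have jTv: "jop (v + a \<cdot>\<^sub>v y) = jop v + a \<cdot>\<^sub>v jop y"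
    using v y by (simp add: mult_add_distrib_mat_vec[OF jmat_carrier] mult_mat_vec[OF jmat_carrier])
  have CTv: "C k *\<^sub>v (jop v + a \<cdot>\<^sub>v jop y) = y + a \<cdot>\<^sub>v v"
    using v y by (simp add: mult_add_distrib_mat_vec[OF C_carrier] mult_mat_vec[OF C_carrier] Cjy flip: y_def)
  have "ip (v + a \<cdot>\<^sub>v y) (jop v + a \<cdot>\<^sub>v jop y) = \<delta> + a * \<gamma> + cnj a * cnj \<gamma> + (a * cnj a) * \<delta>"
    using v y by (simp add: ip_add_left[of _ "2*p"] ip_add_right[of _ "2*p"] ip_smult_left[of _ "2*p"]
        ip_smult_right vy yv yj \<delta>_def[symmetric]) (simp add: algebra_simps)
  moreover have "Im \<gamma> = 0"
  proof -
    have "cnj \<gamma> = \<gamma>" unfolding yv[symmetric] unfolding y_def \<gamma>_def using v by (simp add: ip_C)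
    thus ?thesis by (simp add: complex_eq_iff)
  qed
  ultimately show "jform (T k z *\<^sub>v v) = qz z * jform v - 2 * rz z * gform k v"
    unfolding Tv jTv a2 using aa
    by (simp add: gform_def flip: y_def \<gamma>_def \<delta>_def) (simp add: algebra_simps)
  have "ip (jop v) v = \<delta>" "ip (jop y) y = \<delta>" "ip (jop y) v = cnj \<gamma>"
    using v y yj yv by (simp_all add: \<delta>_def flip: ip_jmat)
  hence "ip (jop v + a \<cdot>\<^sub>v jop y) (y + a \<cdot>\<^sub>v v) = \<gamma> + a * \<delta> + cnj a * \<delta> + (a * cnj a) * cnj \<gamma>"
    using v y by (simp add: ip_add_left[of _ "2*p"] ip_add_right[of _ "2*p"] ip_smult_left[of _ "2*p"]
        ip_smult_right \<gamma>_def[symmetric]) (simp add: algebra_simps)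
  thus "gform k (T k z *\<^sub>v v) = qz z * gform k v - 2 * rz z * jform v"
    unfolding Tv gform_def jTv CTv a2 using aa
    by (simp flip: y_def \<gamma>_def \<delta>_def) (simp add: algebra_simps)
qed

section \<open>Contraction of the discs\<close>

lemma qz_ge_1: "1 \<le> qz z" by (simp add: qz_def)

lemma rz_pos: "z \<in> lower_half \<Longrightarrow> 0 < rz z"
  using lower_halfD[of z] by (simp add: rz_def divide_neg_pos)

text \<open>The product of the factors with indices \<open>s\<close> to \<open>s + n - 1\<close>.
  The free start index lets every later result apply to the tail of the system as well.\<close>

fun P :: "nat \<Rightarrow> nat \<Rightarrow> complex \<Rightarrow> complex mat" where
  "P s 0 z = 1\<^sub>m (2*p)"
| "P s (Suc n) z = T s z * P (Suc s) n z"

lemma P_carrier [simp]: "P s n z \<in> carrier_mat (2*p) (2*p)"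
proof (induction n arbitrary: s)
  case (Suc n)
  show ?case using mult_carrier_mat[OF T_carrier Suc] by simp
qed simp

lemma P_mult_carrier [simp]: "v \<in> carrier_vec (2*p) \<Longrightarrow> P s n z *\<^sub>v v \<in> carrier_vec (2*p)"
  using mult_mat_vec_carrier[OF P_carrier] .

lemma P_Suc_mult:
  "v \<in> carrier_vec (2*p) \<Longrightarrow> P s (Suc n) z *\<^sub>v v = T s z *\<^sub>v (P (Suc s) n z *\<^sub>v v)"
  using assoc_mult_mat_vec[OF T_carrier P_carrier] by simp

lemma P_add_mult:
  "v \<in> carrier_vec (2*p) \<Longrightarrow> P s (n + m) z *\<^sub>v v = P s n z *\<^sub>v (P (s + n) m z *\<^sub>v v)"
proof (induction n arbitrary: s)
  case (Suc n)
  have "P s (Suc n + m) z *\<^sub>v v = T s z *\<^sub>v (P (Suc s) (n + m) z *\<^sub>v v)"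
    using Suc.prems P_Suc_mult[of v s "n + m" z] by simp
  also have "\<dots> = T s z *\<^sub>v (P (Suc s) n z *\<^sub>v (P (s + Suc n) m z *\<^sub>v v))"
    using Suc by simp
  finally show ?case using Suc.prems by (simp add: P_Suc_mult del: P.simps)
qed simp

text \<open>The recursion of \<open>P\<close> peels factors off on the left, while the adjoint of
  \<open>Wsol\<close> receives each new factor on the right.\<close>

lemma P_Suc_right: "P s (Suc n) z = P s n z * T (s + n) z"
proof (induction n arbitrary: s)
  case 0
  show ?case using left_mult_one_mat[OF T_carrier] right_mult_one_mat[OF T_carrier] by simp
next
  case (Suc n)
  have "P s (Suc (Suc n)) z = T s z * (P (Suc s) n z * T (s + Suc n) z)"
    using Suc[of "Suc s"] by simp
  also have "\<dots> = P s (Suc n) z * T (s + Suc n) z"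
    using assoc_mult_mat[OF T_carrier P_carrier T_carrier] by simp
  finally show ?case .
qed

section \<open>The fundamental solution as a product of one-step matrices\<close>

lemma mat_adjoint_C: "mat_adjoint (C k) = C k"
proof -
  note ba = mat_adjoint_carrier[OF b_carrier[of k]]
  have P: "mat_adjoint (bK k) * bK k \<in> carrier_mat (2*p) (2*p)"
    by (rule mult_carrier_mat[OF ba b_carrier])
  show ?thesis
    unfolding Cmat_eq mat_adjoint_minus[OF smult_carrier_mat[OF P] jmat_carrier]
    by (simp add: mat_adjoint_smult mat_adjoint_mult[OF ba b_carrier] mat_adjoint_jmat)
qed

lemma Wsol_carrier: "Wsol p \<beta> n l \<in> carrier_mat (2*p) (2*p)"
proof (induction n)
  case (Suc n)
  show ?case unfolding Wsol.simps
    by (intro minus_carrier_mat smult_carrier_mat mult_carrier_mat[OF _ Suc]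
        mult_carrier_mat[OF jmat_carrier C_carrier])
qed simp

text \<open>The adjoint reverses the order of the factors, and the conjugate of
  \<open>\<i> / cnj z\<close> is \<open>- \<i> / z\<close>, which turns the minus sign of the system
  into the plus sign of \<open>T\<close>.\<close>

lemma adjoint_Wsol_eq_P: "mat_adjoint (Wsol p \<beta> n (cnj z)) = P 0 n z"
proof (induction n)
  case 0
  show ?case by (intro eq_matI) auto
next
  case (Suc n)
  let ?W = "Wsol p \<beta> n (cnj z)"
  note jC = mult_carrier_mat[OF jmat_carrier C_carrier[of n]]
  note Cj = mult_carrier_mat[OF C_carrier[of n] jmat_carrier]
  have adj: "mat_adjoint (jmat p * C n * ?W) = P 0 n z * (C n * jmat p)"
    by (simp add: mat_adjoint_mult[OF jC Wsol_carrier] mat_adjoint_mult[OF jmat_carrier C_carrier]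
        mat_adjoint_C mat_adjoint_jmat Suc)
  have "mat_adjoint (Wsol p \<beta> (Suc n) (cnj z)) =
      P 0 n z - cnj (\<i> / cnj z) \<cdot>\<^sub>m (P 0 n z * (C n * jmat p))"
    unfolding Wsol.simps
    by (subst mat_adjoint_minus[OF Wsol_carrier smult_carrier_mat[OF mult_carrier_mat[OF jC Wsol_carrier]]])
      (simp only: mat_adjoint_smult adj Suc)
  also have "\<dots> = P 0 n z + (\<i> / z) \<cdot>\<^sub>m (P 0 n z * (C n * jmat p))"
    using P_carrier[of 0 n z] mult_carrier_mat[OF P_carrier[of 0 n z] Cj]
    by (intro eq_matI) (auto simp del: index_mult_mat(1))
  also have "\<dots> = P 0 n z * 1\<^sub>m (2*p) + P 0 n z * ((\<i> / z) \<cdot>\<^sub>m (C n * jmat p))"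
    using mult_smult_distrib[OF P_carrier Cj] right_mult_one_mat[OF P_carrier] by simp
  also have "\<dots> = P 0 n z * T n z"
    unfolding T_def
    by (rule mult_add_distrib_mat[OF P_carrier one_carrier_mat smult_carrier_mat[OF Cj], symmetric])
  also have "\<dots> = P 0 (Suc n) z" using P_Suc_right[of 0 n z] by simp
  finally show ?case .
qed

text \<open>Disc \<open>N\<close> comes from \<open>N + 1\<close> factors. There is thus always at
  least one, which is what makes the \<open>j\<close>-form strictly negative below.\<close>

lemma calW_eq: "calW p \<beta> N z = Kmat p * P 0 (Suc N) z"
  unfolding calW_def adjoint_Wsol_eq_P ..

text \<open>In \<open>jform_T\<close> the first term is nonpositive, and the second is strictly
  negative because \<open>gform k\<close> is definite and \<open>rz z\<close> is positive.\<close>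

lemma jform_T_neg:
  assumes z: "z \<in> lower_half" and v: "v \<in> carrier_vec (2*p)" "v \<noteq> 0\<^sub>v (2*p)" "jform v \<le> 0"
  shows "jform (T k z *\<^sub>v v) < 0"
proof -
  obtain c where c: "c > 0" "c * nsq v \<le> gform k v" using gform_lower_bound[of k] v(1) by blast
  have "nsq v > 0" using nsq_nonneg[of v] nsq_eq_0_iff[OF v(1)] v(2) by linarith
  hence "gform k v > 0" using c by (meson less_le_trans mult_pos_pos)
  hence "0 < 2 * rz z * gform k v" using rz_pos[OF z] by simp
  moreover have "qz z * jform v \<le> 0" using qz_ge_1[of z] v(3) by (intro mult_nonneg_nonpos) auto
  ultimately show ?thesis using v(1) by (simp add: jform_T)
qed

lemma jform_zero: "jform (0\<^sub>v (2*p)) = 0"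
  using carrier_matD[OF jmat_carrier[of p]] by (simp add: ip_def del: index_mult_mat_vec)

text \<open>The induction carries both properties together: strict negativity of the image is what
  keeps it nonzero, also where the factors are singular.\<close>

lemma P_nonpos:
  assumes z: "z \<in> lower_half" and v: "v \<in> carrier_vec (2*p)" "v \<noteq> 0\<^sub>v (2*p)" "jform v \<le> 0"
  shows "P s n z *\<^sub>v v \<noteq> 0\<^sub>v (2*p) \<and> jform (P s n z *\<^sub>v v) \<le> 0"
proof (induction n arbitrary: s)
  case (Suc n)
  have "jform (P s (Suc n) z *\<^sub>v v) < 0"
    unfolding P_Suc_mult[OF v(1)] using Suc[of "Suc s"] v(1) z by (intro jform_T_neg) auto
  moreover from this have "P s (Suc n) z *\<^sub>v v \<noteq> 0\<^sub>v (2*p)" using jform_zero by auto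
  ultimately show ?case by simp
qed (use v in auto)

lemma jform_P_nonpos:
  assumes z: "z \<in> lower_half" and v: "v \<in> carrier_vec (2*p)" "jform v \<le> 0"
  shows "jform (P s n z *\<^sub>v v) \<le> 0"
proof (cases "v = 0\<^sub>v (2*p)")
  case True
  have "P s n z *\<^sub>v v = 0\<^sub>v (2*p)" unfolding True using carrier_matD[OF P_carrier[of s n z]]
    by (intro eq_vecI) auto
  thus ?thesis by (simp add: jform_zero)
qed (use P_nonpos[OF z v(1) _ v(2)] in blast)

lemma jform_P_neg:
  assumes z: "z \<in> lower_half" and v: "v \<in> carrier_vec (2*p)" "v \<noteq> 0\<^sub>v (2*p)" "jform v \<le> 0"
  shows "jform (P s (Suc n) z *\<^sub>v v) < 0"
  unfolding P_Suc_mult[OF v(1)] using P_nonpos[OF z v, of "Suc s" n] v(1) z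
  by (intro jform_T_neg) auto

text \<open>Pointwise form of the disc: the rotated graph \<open>K\<^sup>* (f, - \<i> \<phi> f)\<close> consists of images of
  \<open>j\<close>-nonpositive vectors.\<close>

definition in_disc :: "nat \<Rightarrow> nat \<Rightarrow> complex \<Rightarrow> complex mat \<Rightarrow> bool" where
  "in_disc s n z \<phi> \<longleftrightarrow> \<phi> \<in> carrier_mat p p \<and>
    (\<forall>f\<in>carrier_vec p. \<exists>v\<in>carrier_vec (2*p). jform v \<le> 0 \<and>
       P s n z *\<^sub>v v = mat_adjoint (Kmat p) *\<^sub>v (f @\<^sub>v (- \<i>) \<cdot>\<^sub>v (\<phi> *\<^sub>v f)))"

text \<open>The discs are nested: the last \<open>m\<close> factors are absorbed into the vector,
  which stays \<open>j\<close>-nonpositive.\<close>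

lemma in_disc_mono:
  assumes z: "z \<in> lower_half" and d: "in_disc s (n + m) z \<phi>"
  shows "in_disc s n z \<phi>"
  unfolding in_disc_def
proof (intro conjI ballI)
  show "\<phi> \<in> carrier_mat p p" using d by (simp add: in_disc_def)
  fix f :: "complex vec" assume f: "f \<in> carrier_vec p"
  then obtain v where v: "v \<in> carrier_vec (2*p)" "jform v \<le> 0"
    "P s (n + m) z *\<^sub>v v = mat_adjoint (Kmat p) *\<^sub>v (f @\<^sub>v (- \<i>) \<cdot>\<^sub>v (\<phi> *\<^sub>v f))"
    using d unfolding in_disc_def by blast
  show "\<exists>v\<in>carrier_vec (2*p). jform v \<le> 0 \<and>
       P s n z *\<^sub>v v = mat_adjoint (Kmat p) *\<^sub>v (f @\<^sub>v (- \<i>) \<cdot>\<^sub>v (\<phi> *\<^sub>v f))"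
    using v z jform_P_nonpos[OF z v(1,2)] P_add_mult[OF v(1), of s n m z]
    by (intro bexI[of _ "P (s + n) m z *\<^sub>v v"]) auto
qed

text \<open>What remains of \<open>P s n z v\<close> after deleting the first \<open>k\<close>
  factors: index 0 is the full image and index \<open>n\<close> is \<open>v\<close> itself.\<close>

definition chain :: "nat \<Rightarrow> nat \<Rightarrow> complex \<Rightarrow> complex vec \<Rightarrow> nat \<Rightarrow> complex vec" where
  "chain s n z v k = P (s + k) (n - k) z *\<^sub>v v"

lemma chain_carrier [simp]: "v \<in> carrier_vec (2*p) \<Longrightarrow> chain s n z v k \<in> carrier_vec (2*p)"
  by (simp add: chain_def)

lemma chain_step:
  assumes "v \<in> carrier_vec (2*p)" "k < n"
  shows "chain s n z v k = T (s + k) z *\<^sub>v chain s n z v (Suc k)"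
  using assms P_Suc_mult[of v "s + k" "n - Suc k" z] Suc_diff_Suc[of k n]
  by (simp add: chain_def del: P.simps)

lemma chain_jform:
  assumes "v \<in> carrier_vec (2*p)" "k < n"
  shows "jform (chain s n z v k) =
    qz z * jform (chain s n z v (Suc k)) - 2 * rz z * gform (s + k) (chain s n z v (Suc k))"
  using assms by (simp add: chain_step jform_T)

lemma chain_sum:
  assumes "v \<in> carrier_vec (2*p)"
  shows "jform (P s n z *\<^sub>v v) = qz z ^ n * jform v -
    2 * rz z * (\<Sum>k<n. qz z ^ k * gform (s + k) (chain s n z v (Suc k)))"
  using sum_of_backward_recursion[of n "\<lambda>k. jform (chain s n z v k)" "qz z" "rz z"
      "\<lambda>k. gform (s + k) (chain s n z v (Suc k))"] chain_jform[OF assms] assms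
  by (simp add: chain_def del: P.simps(2))

lemma chain_sum_le:
  assumes "v \<in> carrier_vec (2*p)" "jform v \<le> 0"
  shows "2 * rz z * (\<Sum>k<n. qz z ^ k * gform (s + k) (chain s n z v (Suc k)))
    \<le> - jform (P s n z *\<^sub>v v)"
proof -
  have "qz z ^ n * jform v \<le> 0" using qz_ge_1[of z] assms(2) by (intro mult_nonneg_nonpos) auto
  thus ?thesis using chain_sum[OF assms(1), of s n z] by linarith
qed

text \<open>The form equals \<open>2 * Re (ip f g)\<close>, so only \<open>g\<close> has to be
  controlled. Definiteness of \<open>gform s\<close> bounds \<open>nsq g\<close> by the form itself,
  and a weighted inequality then absorbs \<open>g\<close>. The constant \<open>c\<close> enters at
  the start index only, so the bound does not depend on \<open>n\<close>.\<close>

lemma jform_P_bound: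
  assumes z: "z \<in> lower_half" and n: "n > 0"
    and c: "c > 0" "\<And>v. v \<in> carrier_vec (2*p) \<Longrightarrow> c * nsq v \<le> gform s v"
    and v: "v \<in> carrier_vec (2*p)" "jform v \<le> 0"
    and f: "f \<in> carrier_vec p" and g: "g \<in> carrier_vec p"
    and eq: "P s n z *\<^sub>v v = mat_adjoint (Kmat p) *\<^sub>v (f @\<^sub>v g)"
  shows "- jform (P s n z *\<^sub>v v) \<le> 2 * (qz z + 2 * rz z) / (rz z * c) * nsq f"
proof -
  define q where "q = qz z"
  define r where "r = rz z"
  have q: "q \<ge> 1" using qz_ge_1 by (simp add: q_def)
  have r: "r > 0" using rz_pos[OF z] by (simp add: r_def)
  define u where "u = P s n z *\<^sub>v v"
  define x where "x = chain s n z v (Suc 0)"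
  have x: "x \<in> carrier_vec (2*p)" using v by (simp add: x_def)
  have ux: "u = T s z *\<^sub>v x" using chain_step[OF v(1) n, of s z] by (simp add: u_def x_def chain_def)
  \<comment> \<open>Of the sum in \<open>chain_sum_le\<close> only the first summand is
    kept.\<close>
  have "gform s x = (\<Sum>k\<in>{0}. q ^ k * gform (s + k) (chain s n z v (Suc k)))"
    by (simp add: x_def)
  also have "\<dots> \<le> (\<Sum>k<n. q ^ k * gform (s + k) (chain s n z v (Suc k)))"
    using n q v(1) by (intro sum_mono2) (auto intro!: mult_nonneg_nonneg gform_nonneg)
  finally have "2 * r * gform s x \<le> 2 * r * (\<Sum>k<n. q ^ k * gform (s + k) (chain s n z v (Suc k)))"
    using r by (intro mult_left_mono) auto
  also have "\<dots> \<le> - jform u" using chain_sum_le[OF v, of z s n] by (simp add: u_def q_def r_def)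
  finally have 1: "2 * r * gform s x \<le> - jform u" .
  have "gform s u = q * gform s x - 2 * r * jform x"
    unfolding ux q_def r_def by (rule gform_T[OF x])
  also have "- jform x \<le> gform s x" using gform_ge_abs_jform[OF x, of s] by linarith
  hence "2 * r * (- jform x) \<le> 2 * r * gform s x" using r by (intro mult_left_mono) auto
  hence "q * gform s x - 2 * r * jform x \<le> (q + 2 * r) * gform s x"
    unfolding distrib_right mult_minus_right by linarith
  finally have 2: "gform s u \<le> (q + 2 * r) * gform s x" .
  have nu: "nsq u = nsq f + nsq g" unfolding u_def eq by (rule nsq_adjoint_Kmat[OF f g])
  have "c * nsq g \<le> c * nsq u" using c(1) nsq_nonneg[of f] by (intro mult_left_mono) (auto simp: nu)
  also have "\<dots> \<le> (q + 2 * r) * gform s x" using c(2)[of u] 2 v by (simp add: u_def del: P.simps)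
  finally have 3: "c * nsq g \<le> (q + 2 * r) * gform s x" .
  \<comment> \<open>Chosen so that \<open>3\<close>, scaled by \<open>2 * r / (q + 2 * r)\<close>,
    reads \<open>e * nsq g \<le> 2 * r * gform s x\<close>.\<close>
  define e where "e = 2 * r * c / (q + 2 * r)"
  have e: "e > 0" using q r c(1) by (simp add: e_def)
  have "e * nsq g \<le> 2 * r * gform s x"
  proof -
    have "2 * r * (c * nsq g) \<le> 2 * r * ((q + 2 * r) * gform s x)"
      using 3 r by (intro mult_left_mono) auto
    thus ?thesis using q r by (simp add: e_def field_simps)
  qed
  hence 4: "e * nsq g \<le> - jform u" using 1 by linarith
  have "- jform u = - 2 * Re (ip f g)" unfolding u_def eq j_form_adjoint_Kmat[OF f g] by simp
  \<comment> \<open>The weight \<open>2 / e\<close> makes the \<open>g\<close> term at most half of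
    the left-hand side.\<close>
  also have "\<dots> \<le> (2 / e) * nsq f + nsq g / (2 / e)" using e by (intro am_gm_ip[OF f g]) simp
  also have "nsq g / (2 / e) = (e * nsq g) / 2" using e by simp
  also have "\<dots> \<le> (- jform u) / 2" using 4 by simp
  finally have "- jform u \<le> 4 / e * nsq f" by simp
  also have "4 / e = 2 * (q + 2 * r) / (r * c)" using q r c(1) by (simp add: e_def field_simps)
  finally show ?thesis by (simp add: u_def q_def r_def)
qed

text \<open>The constant produced by \<open>disc_diameter\<close>. Divided by the number of factors
  it bounds the square of the diameter.\<close>

definition disc_bound :: "real \<Rightarrow> complex \<Rightarrow> real" where
  "disc_bound c z = 2 * (qz z)\<^sup>2 * (qz z + 2 * rz z) / (rz z ^ 3 * c\<^sup>2)"

text \<open>The difference of two elements of the disc gives a chain starting at a \<open>j\<close>-neutral vector.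
  Along it \<open>q\<^sup>k jform\<close> increases, so the sum in \<open>chain_sum\<close> grows linearly in \<open>n\<close>.\<close>

lemma disc_diameter:
  assumes z: "z \<in> lower_half" and n: "n > 0"
    and c: "c > 0" "\<And>v. v \<in> carrier_vec (2*p) \<Longrightarrow> c * nsq v \<le> gform s v"
    and d: "in_disc s n z \<phi>" "in_disc s n z \<psi>" and f: "f \<in> carrier_vec p"
  shows "nsq ((\<phi> - \<psi>) *\<^sub>v f) \<le> disc_bound c z / n * nsq f"
proof -
  define q where "q = qz z"
  define r where "r = rz z"
  have q: "q \<ge> 1" using qz_ge_1 by (simp add: q_def)
  have r: "r > 0" using rz_pos[OF z] by (simp add: r_def)
  have \<phi>: "\<phi> \<in> carrier_mat p p" and \<psi>: "\<psi> \<in> carrier_mat p p" using d by (auto simp: in_disc_def)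
  define g where "g = (- \<i>) \<cdot>\<^sub>v (\<phi> *\<^sub>v f)"
  define h where "h = (- \<i>) \<cdot>\<^sub>v (\<psi> *\<^sub>v f)"
  have g: "g \<in> carrier_vec p" and h: "h \<in> carrier_vec p"
    unfolding g_def h_def using mult_mat_vec_carrier[OF \<phi> f] mult_mat_vec_carrier[OF \<psi> f] by auto
  obtain v where v: "v \<in> carrier_vec (2*p)" "jform v \<le> 0" "P s n z *\<^sub>v v = mat_adjoint (Kmat p) *\<^sub>v (f @\<^sub>v g)"
    using d(1) f unfolding in_disc_def g_def by blast
  obtain u where u: "u \<in> carrier_vec (2*p)" "jform u \<le> 0" "P s n z *\<^sub>v u = mat_adjoint (Kmat p) *\<^sub>v (f @\<^sub>v h)"
    using d(2) f unfolding in_disc_def h_def by blast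
  define x where "x = v - u"
  have x: "x \<in> carrier_vec (2*p)" using u v by (simp add: x_def)
  define w where "w = chain s n z x"
  have w: "w k \<in> carrier_vec (2*p)" for k using x by (simp add: w_def)
  have w_diff: "w k = chain s n z v k - chain s n z u k" for k
    unfolding w_def chain_def x_def by (rule mult_minus_distrib_mat_vec[OF P_carrier v(1) u(1)])
  have gh: "g - h = (- \<i>) \<cdot>\<^sub>v ((\<phi> - \<psi>) *\<^sub>v f)"
    unfolding g_def h_def minus_mult_distrib_mat_vec[OF \<phi> \<psi> f]
    using \<phi> \<psi> by (intro eq_vecI) (auto simp: algebra_simps simp del: index_mult_mat_vec)
  have w0: "w 0 = mat_adjoint (Kmat p) *\<^sub>v (0\<^sub>v p @\<^sub>v (g - h))"
  proof -
    have "w 0 = mat_adjoint (Kmat p) *\<^sub>v (f @\<^sub>v g) - mat_adjoint (Kmat p) *\<^sub>v (f @\<^sub>v h)"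
      using u v by (simp add: w_diff chain_def)
    also have "\<dots> = mat_adjoint (Kmat p) *\<^sub>v ((f @\<^sub>v g) - (f @\<^sub>v h))"
      using f g h by (intro mult_minus_distrib_mat_vec[OF mat_adjoint_carrier[OF Kmat_carrier], symmetric]) auto
    also have "(f @\<^sub>v g) - (f @\<^sub>v h) = 0\<^sub>v p @\<^sub>v (g - h)"
      using f g h by (intro eq_vecI) auto
    finally show ?thesis .
  qed
  have jw0: "jform (w 0) = 0"
    unfolding w0 using g h by (subst j_form_adjoint_Kmat) (auto simp: ip_def)
  have nw0: "nsq (w 0) = nsq ((\<phi> - \<psi>) *\<^sub>v f)"
  proof -
    have "nsq (w 0) = nsq (g - h)"
      unfolding w0 using g h by (subst nsq_adjoint_Kmat) (auto simp: ip_def)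
    also have "\<dots> = nsq ((\<phi> - \<psi>) *\<^sub>v f)"
      unfolding gh nsq_eq_sum by (auto simp: norm_mult intro!: sum.cong)
    finally show ?thesis .
  qed
  have step: "jform (w k) = q * jform (w (Suc k)) - 2 * r * gform (s + k) (w (Suc k))" if "k < n" for k
    unfolding w_def q_def r_def by (rule chain_jform[OF x that])
  \<comment> \<open>In \<open>step\<close> the term with \<open>gform\<close> is subtracted and
    nonnegative, so each step outward multiplies the form by \<open>q\<close> at least up to
    inequality.\<close>
  have grow: "jform (w (Suc 0)) \<le> q ^ k * jform (w (Suc k))" if "k < n" for k
    using that
  proof (induction k)
    case (Suc k)
    have "jform (w (Suc k)) \<le> q * jform (w (Suc (Suc k)))"
      using step[OF Suc.prems] r gform_nonneg[OF w[of "Suc (Suc k)"], of "s + Suc k"] by simp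
    hence "q ^ k * jform (w (Suc k)) \<le> q ^ k * (q * jform (w (Suc (Suc k))))"
      using q by (intro mult_left_mono) auto
    thus ?case using Suc by (simp add: mult_ac)
  qed simp
  define S where "S y = (\<Sum>k<n. q ^ k * gform (s + k) (chain s n z y (Suc k)))" for y
  have "n * jform (w (Suc 0)) = (\<Sum>k<n. jform (w (Suc 0)))" by simp
  also have "\<dots> \<le> S x"
    unfolding S_def w_def[symmetric]
  proof (rule sum_mono)
    fix k assume "k \<in> {..<n}"
    hence "jform (w (Suc 0)) \<le> q ^ k * jform (w (Suc k))" using grow by simp
    also have "jform (w (Suc k)) \<le> gform (s + k) (w (Suc k))"
      using gform_ge_abs_jform[OF w, of "Suc k" "s + k"] by linarith
    hence "q ^ k * jform (w (Suc k)) \<le> q ^ k * gform (s + k) (w (Suc k))"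
      using q by (intro mult_left_mono) auto
    finally show "jform (w (Suc 0)) \<le> q ^ k * gform (s + k) (w (Suc k))" .
  qed
  also have "\<dots> \<le> 2 * S v + 2 * S u"
  proof -
    have "S x \<le> (\<Sum>k<n. q ^ k * (2 * gform (s + k) (chain s n z v (Suc k)) + 2 * gform (s + k) (chain s n z u (Suc k))))"
      unfolding S_def w_def[symmetric] w_diff using q u v
      by (intro sum_mono mult_left_mono gform_diff_le) auto
    also have "\<dots> = 2 * S v + 2 * S u"
      by (simp add: S_def distrib_left sum.distrib sum_distrib_left mult.left_commute)
    finally show ?thesis .
  qed
  finally have A: "n * jform (w (Suc 0)) \<le> 2 * S v + 2 * S u" .
  \<comment> \<open>The bound of \<open>jform_P_bound\<close>, valid for both chains and independent
    of \<open>n\<close>, against which the linear growth is played.\<close>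
  define M where "M = 2 * (q + 2 * r) / (r * c) * nsq f"
  have "2 * r * S v \<le> M" "2 * r * S u \<le> M"
    using chain_sum_le[OF v(1,2), of z s n] jform_P_bound[OF z n c v(1,2) f g v(3)]
      chain_sum_le[OF u(1,2), of z s n] jform_P_bound[OF z n c u(1,2) f h u(3)]
    by (auto simp: S_def M_def q_def r_def)
  hence "r * (2 * S v + 2 * S u) \<le> 2 * M" by (simp add: algebra_simps)
  moreover have "r * (n * jform (w (Suc 0))) \<le> r * (2 * S v + 2 * S u)"
    using A r by (intro mult_left_mono) auto
  ultimately have B: "r * (n * jform (w (Suc 0))) \<le> 2 * M" by linarith
  \<comment> \<open>As \<open>w 0\<close> is \<open>j\<close>-neutral, the first step makes
    \<open>gform s (w 1)\<close> a multiple of the \<open>j\<close>-form of \<open>w 1\<close>. This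
    converts the bound \<open>B\<close> on the latter into a bound on the norm of
    \<open>w 0\<close>.\<close>
  have j1: "q * jform (w (Suc 0)) = 2 * r * gform s (w (Suc 0))"
    using step[OF n] jw0 by simp
  have "jform (w (Suc 0)) \<ge> 0"
  proof -
    have "0 \<le> q * jform (w (Suc 0))" unfolding j1 using r gform_nonneg[OF w] by simp
    thus ?thesis using q by (simp add: zero_le_mult_iff)
  qed
  hence "gform s (w 0) \<le> q * gform s (w (Suc 0))"
    using gform_T[OF w[of "Suc 0"], of s z] chain_step[OF x n, of s z] r
    by (simp add: w_def q_def r_def)
  hence "2 * r * gform s (w 0) \<le> 2 * r * (q * gform s (w (Suc 0)))"
    using r by (intro mult_left_mono) auto
  also have "\<dots> = q\<^sup>2 * jform (w (Suc 0))" using j1 by (simp add: power2_eq_square mult_ac)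
  finally have "2 * r * gform s (w 0) \<le> q\<^sup>2 * jform (w (Suc 0))" .
  moreover have "2 * r * (c * nsq (w 0)) \<le> 2 * r * gform s (w 0)"
    using c(2)[OF w] r by (intro mult_left_mono) auto
  ultimately have "2 * r * (c * nsq (w 0)) \<le> q\<^sup>2 * jform (w (Suc 0))" by linarith
  hence "r * n * (2 * r * (c * nsq (w 0))) \<le> r * n * (q\<^sup>2 * jform (w (Suc 0)))"
    using r by (intro mult_left_mono) auto
  also have "\<dots> = q\<^sup>2 * (r * (n * jform (w (Suc 0))))" by (simp add: mult_ac)
  also have "\<dots> \<le> q\<^sup>2 * (2 * M)" using B by (intro mult_left_mono) auto
  finally have F: "r * n * (2 * r * (c * nsq (w 0))) \<le> q\<^sup>2 * (2 * M)" .
  have pos: "r * n * (2 * r * c) > 0" using r n c(1) by simp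
  have "nsq (w 0) \<le> q\<^sup>2 * (2 * M) / (r * n * (2 * r * c))"
    using F pos by (simp add: pos_le_divide_eq mult_ac)
  also have "\<dots> = disc_bound c z / n * nsq f"
    using r n c(1) unfolding disc_bound_def M_def q_def[symmetric] r_def[symmetric]
    by (simp add: field_simps power2_eq_square power3_eq_cube)
  finally show ?thesis unfolding nw0 .
qed

section \<open>Linear fractions and centres\<close>

lemma jform_append:
  assumes x: "x \<in> carrier_vec p" and y: "y \<in> carrier_vec p"
  shows "jform (x @\<^sub>v y) = nsq x - nsq y"
proof -
  have "ip y (- y) = - ip y y" by (simp add: ip_def sum_negf)
  thus ?thesis using x y by (simp add: jmat_mult_append ip_append[of _ p _ p])
qed

lemma KP_carrier [simp]: "Kmat p * P s n z \<in> carrier_mat (2*p) (2*p)"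
  by (rule mult_carrier_mat[OF Kmat_carrier P_carrier])

lemma KP_mult: "v \<in> carrier_vec (2*p) \<Longrightarrow> (Kmat p * P s n z) *\<^sub>v v = Kmat p *\<^sub>v (P s n z *\<^sub>v v)"
  by (rule assoc_mult_mat_vec[OF Kmat_carrier P_carrier])

lemma P_mult_pair:
  assumes RQ: "R \<in> carrier_mat p p" "Q \<in> carrier_mat p p" and y: "y \<in> carrier_vec p"
  shows "P s n z *\<^sub>v ((R *\<^sub>v y) @\<^sub>v (Q *\<^sub>v y)) = mat_adjoint (Kmat p) *\<^sub>v
    ((top_fac p (Kmat p * P s n z) R Q *\<^sub>v y) @\<^sub>v (bot_fac p (Kmat p * P s n z) R Q *\<^sub>v y))"
proof -
  have v: "(R *\<^sub>v y) @\<^sub>v (Q *\<^sub>v y) \<in> carrier_vec (2*p)"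
    using mult_mat_vec_carrier[OF RQ(1) y] mult_mat_vec_carrier[OF RQ(2) y] by simp
  show ?thesis
    unfolding fac_mult[OF KP_carrier RQ y, symmetric] KP_mult[OF v]
    using v by (simp add: adjoint_Kmat_Kmat)
qed

text \<open>The conditions on a parameter pair at one point, expressed on vectors. Once
  \<open>R\<close> is dominated by \<open>Q\<close>, positivity of the sum of the two forms amounts
  to positivity of that of \<open>Q\<close>.\<close>

definition good_pair :: "complex mat \<Rightarrow> complex mat \<Rightarrow> bool" where
  "good_pair R Q \<longleftrightarrow> R \<in> carrier_mat p p \<and> Q \<in> carrier_mat p p \<and>
    (\<forall>y\<in>carrier_vec p. nsq (R *\<^sub>v y) \<le> nsq (Q *\<^sub>v y) \<and> (y \<noteq> 0\<^sub>v p \<longrightarrow> nsq (Q *\<^sub>v y) > 0))"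

lemma good_pair_vec:
  assumes g: "good_pair R Q" and y: "y \<in> carrier_vec p"
  defines "v \<equiv> (R *\<^sub>v y) @\<^sub>v (Q *\<^sub>v y)"
  shows "v \<in> carrier_vec (2*p)" "jform v \<le> 0" "y \<noteq> 0\<^sub>v p \<Longrightarrow> v \<noteq> 0\<^sub>v (2*p)"
proof -
  have R: "R *\<^sub>v y \<in> carrier_vec p" and Q: "Q *\<^sub>v y \<in> carrier_vec p"
    using g y mult_mat_vec_carrier by (auto simp: good_pair_def)
  show "v \<in> carrier_vec (2*p)" using R Q by (simp add: v_def)
  show "jform v \<le> 0" using g y by (simp add: v_def jform_append[OF R Q] good_pair_def)
  assume "y \<noteq> 0\<^sub>v p"
  hence "nsq (Q *\<^sub>v y) > 0" using g y by (simp add: good_pair_def)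
  moreover have "nsq v = nsq (R *\<^sub>v y) + nsq (Q *\<^sub>v y)"
    unfolding v_def using R Q by (simp add: ip_append[of _ p _ p])
  ultimately have "nsq v > 0" using nsq_nonneg[of "R *\<^sub>v y"] by simp
  thus "v \<noteq> 0\<^sub>v (2*p)" by (auto simp: ip_def)
qed

text \<open>If the denominator killed a nonzero \<open>y\<close>, the image of the corresponding
  vector would have zero upper half in rotated coordinates and be \<open>j\<close>-neutral, whereas
  at least one factor makes its form strictly negative.\<close>

lemma det_top_fac:
  assumes z: "z \<in> lower_half" and g: "good_pair R Q"
  shows "det (top_fac p (Kmat p * P s (Suc n) z) R Q) \<noteq> 0"
proof
  let ?D = "top_fac p (Kmat p * P s (Suc n) z) R Q" and ?U = "bot_fac p (Kmat p * P s (Suc n) z) R Q"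
  have RQ: "R \<in> carrier_mat p p" "Q \<in> carrier_mat p p" using g by (auto simp: good_pair_def)
  note DU = fac_carrier[OF KP_carrier[of s "Suc n" z] RQ]
  assume "det ?D = 0"
  then obtain y where y: "y \<in> carrier_vec p" "y \<noteq> 0\<^sub>v p" "?D *\<^sub>v y = 0\<^sub>v p"
    using det_0_iff_vec_prod_zero_field[OF DU(1)] by blast
  note v = good_pair_vec[OF g y(1)]
  have "jform (P s (Suc n) z *\<^sub>v ((R *\<^sub>v y) @\<^sub>v (Q *\<^sub>v y))) < 0"
    by (rule jform_P_neg[OF z v(1) v(3)[OF y(2)] v(2)])
  moreover have "jform (P s (Suc n) z *\<^sub>v ((R *\<^sub>v y) @\<^sub>v (Q *\<^sub>v y))) = 0"
    unfolding P_mult_pair[OF RQ y(1)] y(3) using mult_mat_vec_carrier[OF DU(2) y(1)]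
    by (subst j_form_adjoint_Kmat) auto
  ultimately show False by simp
qed

lemma bot_fac_mult:
  assumes RQ: "R \<in> carrier_mat p p" "Q \<in> carrier_mat p p" and F: "F \<in> carrier_mat p p"
    and M: "M \<in> carrier_mat (2*p) (2*p)"
    and eq: "F * top_fac p M R Q = \<i> \<cdot>\<^sub>m bot_fac p M R Q" and y: "y \<in> carrier_vec p"
  shows "bot_fac p M R Q *\<^sub>v y = (- \<i>) \<cdot>\<^sub>v (F *\<^sub>v (top_fac p M R Q *\<^sub>v y))"
proof -
  note DU = fac_carrier[OF M RQ]
  have "F *\<^sub>v (top_fac p M R Q *\<^sub>v y) = (\<i> \<cdot>\<^sub>m bot_fac p M R Q) *\<^sub>v y"
    using assoc_mult_mat_vec[OF F DU(1) y] eq by simp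
  also have "\<dots> = \<i> \<cdot>\<^sub>v (bot_fac p M R Q *\<^sub>v y)" using DU y by (intro eq_vecI) auto
  finally show ?thesis by (simp add: smult_smult_assoc)
qed

text \<open>The denominator is invertible, so every \<open>f\<close> is its value at some
  \<open>y\<close>; the vector formed by \<open>R y\<close> and \<open>Q y\<close> is the required
  preimage.\<close>

lemma in_disc_fraction:
  assumes z: "z \<in> lower_half" and g: "good_pair R Q" and F: "F \<in> carrier_mat p p"
    and eq: "F * top_fac p (Kmat p * P s (Suc n) z) R Q = \<i> \<cdot>\<^sub>m bot_fac p (Kmat p * P s (Suc n) z) R Q"
  shows "in_disc s (Suc n) z F"
  unfolding in_disc_def
proof (intro conjI ballI F)
  fix f :: "complex vec" assume f: "f \<in> carrier_vec p"
  let ?D = "top_fac p (Kmat p * P s (Suc n) z) R Q"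
  have RQ: "R \<in> carrier_mat p p" "Q \<in> carrier_mat p p" using g by (auto simp: good_pair_def)
  note DU = fac_carrier[OF KP_carrier[of s "Suc n" z] RQ]
  obtain y where y: "y \<in> carrier_vec p" "?D *\<^sub>v y = f"
    using mult_mat_vec_surj[OF DU(1) det_top_fac[OF z g] f] by blast
  show "\<exists>v\<in>carrier_vec (2*p). jform v \<le> 0 \<and>
       P s (Suc n) z *\<^sub>v v = mat_adjoint (Kmat p) *\<^sub>v (f @\<^sub>v (- \<i>) \<cdot>\<^sub>v (F *\<^sub>v f))"
    using good_pair_vec[OF g y(1)] P_mult_pair[OF RQ y(1), of s "Suc n" z]
      bot_fac_mult[OF RQ F KP_carrier eq y(1)] y(2)
    by (intro bexI[of _ "(R *\<^sub>v y) @\<^sub>v (Q *\<^sub>v y)"]) (auto simp del: P.simps)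
qed

section \<open>Holomorphy in z and the image of the zero parameter\<close>

lemma T_holomorphic:
  assumes "a < 2*p" "b < 2*p"
  shows "(\<lambda>z. T k z $$ (a, b)) holomorphic_on lower_half"
proof -
  have "(\<lambda>z. 1\<^sub>m (2*p) $$ (a, b) + (\<i> / z) * (C k * jmat p) $$ (a, b)) holomorphic_on lower_half"
    by (intro holomorphic_intros) (auto simp: lower_half_def)
  moreover have "T k z $$ (a, b) = 1\<^sub>m (2*p) $$ (a, b) + (\<i> / z) * (C k * jmat p) $$ (a, b)" for z
    using assms carrier_matD[OF C_carrier[of k]] carrier_matD[OF jmat_carrier[of p]]
    unfolding T_def by (simp del: index_mult_mat(1))
  ultimately show ?thesis by simp
qed

lemma P_holomorphic: "a < 2*p \<Longrightarrow> b < 2*p \<Longrightarrow> (\<lambda>z. P s n z $$ (a, b)) holomorphic_on lower_half"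
proof (induction n arbitrary: s a b)
  case (Suc n)
  show ?case unfolding P.simps
    by (rule mat_mult_holomorphic[of _ _ "2*p" "2*p" _ "2*p"]) (use Suc T_holomorphic in auto)
qed simp

lemma KP_holomorphic:
  "a < 2*p \<Longrightarrow> b < 2*p \<Longrightarrow> (\<lambda>z. (Kmat p * P s n z) $$ (a, b)) holomorphic_on lower_half"
  by (rule mat_mult_holomorphic[of _ _ "2*p" "2*p" _ "2*p"]) (auto intro: P_holomorphic)

abbreviation Dc :: "nat \<Rightarrow> nat \<Rightarrow> complex \<Rightarrow> complex mat" where
  "Dc s n z \<equiv> top_fac p (Kmat p * P s n z) (0\<^sub>m p p) (1\<^sub>m p)"
abbreviation Uc :: "nat \<Rightarrow> nat \<Rightarrow> complex \<Rightarrow> complex mat" where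
  "Uc s n z \<equiv> bot_fac p (Kmat p * P s n z) (0\<^sub>m p p) (1\<^sub>m p)"

text \<open>The fraction for \<open>R = 0\<close>, \<open>Q = 1\<close>. Writing the inverse through
  adjugate and determinant makes holomorphy of the entries accessible.\<close>

definition centre :: "nat \<Rightarrow> nat \<Rightarrow> complex \<Rightarrow> complex mat" where
  "centre s n z = (\<i> / det (Dc s n z)) \<cdot>\<^sub>m (Uc s n z * adj_mat (Dc s n z))"

lemma Dc_carrier [simp]: "Dc s n z \<in> carrier_mat p p"
  and Uc_carrier [simp]: "Uc s n z \<in> carrier_mat p p"
  by (auto intro!: fac_carrier)

lemma centre_carrier [simp]: "centre s n z \<in> carrier_mat p p"
  unfolding centre_def
  by (rule smult_carrier_mat[OF mult_carrier_mat[OF Uc_carrier adj_mat(1)[OF Dc_carrier]]])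

lemma good_pair_01: "good_pair (0\<^sub>m p p) (1\<^sub>m p)"
proof -
  have "nsq (0\<^sub>m p p *\<^sub>v y) \<le> nsq y \<and> (y \<noteq> 0\<^sub>v p \<longrightarrow> nsq y > 0)" if y: "y \<in> carrier_vec p" for y
  proof -
    have "nsq (0\<^sub>m p p *\<^sub>v y) = 0" using y by (simp add: ip_def)
    thus ?thesis using nsq_nonneg[of y] nsq_eq_0_iff[OF y] by auto
  qed
  thus ?thesis by (auto simp: good_pair_def)
qed

lemma centre_eq:
  assumes z: "z \<in> lower_half"
  shows "centre s (Suc n) z * Dc s (Suc n) z = \<i> \<cdot>\<^sub>m Uc s (Suc n) z"
proof -
  let ?D = "Dc s (Suc n) z" and ?U = "Uc s (Suc n) z"
  note adj = adj_mat[OF Dc_carrier[of s "Suc n" z]]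
  have "centre s (Suc n) z * ?D = (\<i> / det ?D) \<cdot>\<^sub>m (?U * adj_mat ?D * ?D)"
    unfolding centre_def by (rule mult_smult_assoc_mat[OF mult_carrier_mat[OF Uc_carrier adj(1)] Dc_carrier])
  also have "?U * adj_mat ?D * ?D = ?U * (det ?D \<cdot>\<^sub>m 1\<^sub>m p)"
    unfolding assoc_mult_mat[OF Uc_carrier adj(1) Dc_carrier] adj(3) ..
  also have "\<dots> = det ?D \<cdot>\<^sub>m ?U"
    unfolding mult_smult_distrib[OF Uc_carrier one_carrier_mat] right_mult_one_mat[OF Uc_carrier] ..
  finally show ?thesis using det_top_fac[OF z good_pair_01, of s n]
    by (intro eq_matI) (auto simp del: P.simps)
qed

lemma centre_in_disc: "z \<in> lower_half \<Longrightarrow> in_disc s (Suc n) z (centre s (Suc n) z)"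
  by (rule in_disc_fraction[OF _ good_pair_01 centre_carrier centre_eq])

lemma centre_holomorphic:
  assumes ab: "a < p" "b < p"
  shows "(\<lambda>z. centre s (Suc n) z $$ (a, b)) holomorphic_on lower_half"
proof -
  let ?D = "Dc s (Suc n)" and ?U = "Uc s (Suc n)" and ?M = "\<lambda>z. Kmat p * P s (Suc n) z"
  \<comment> \<open>For this pair, denominator and numerator are just the blocks of the second block
    column.\<close>
  have e: "?D z $$ (i, k) = ?M z $$ (i, k + p)" "?U z $$ (i, k) = ?M z $$ (i + p, k + p)"
    if "i < p" "k < p" for i k z
    using that left_mult_zero_mat carrier_matD[OF KP_carrier[of s "Suc n" z]]
      right_mult_one_mat[OF blk_carrier(2)[OF KP_carrier[of s "Suc n" z]]]
      right_mult_one_mat[OF blk_carrier(4)[OF KP_carrier[of s "Suc n" z]]]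
      right_mult_zero_mat[OF blk_carrier(1)[OF KP_carrier[of s "Suc n" z]], of p]
      right_mult_zero_mat[OF blk_carrier(3)[OF KP_carrier[of s "Suc n" z]], of p]
    unfolding top_fac_def bot_fac_def
    by (simp_all add: split_block_def Let_def del: P.simps index_mult_mat)
  have hD: "(\<lambda>z. ?D z $$ (i, k)) holomorphic_on lower_half"
    and hU: "(\<lambda>z. ?U z $$ (i, k)) holomorphic_on lower_half" if "i < p" "k < p" for i k
    unfolding e[OF that] using that by (auto intro!: KP_holomorphic simp del: P.simps)
  have "(\<lambda>z. \<i> / det (?D z) * (?U z * adj_mat (?D z)) $$ (a, b)) holomorphic_on lower_half"
    using det_top_fac[OF _ good_pair_01, of _ s n] ab
    by (intro holomorphic_intros det_holomorphic[of _ _ p] mat_mult_holomorphic[of _ _ p p _ p] hD hU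
        adj_mat_holomorphic[of _ _ p] adj_mat(1) Dc_carrier Uc_carrier) auto
  thus ?thesis
    using ab carrier_matD[OF Uc_carrier[of s "Suc n"]] carrier_matD[OF adj_mat(1)[OF Dc_carrier[of s "Suc n"]]]
    by (simp add: centre_def del: index_mult_mat(1) P.simps)
qed

section \<open>The limit\<close>

text \<open>One definiteness constant per start index, fixed for all \<open>z\<close> and
  \<open>n\<close>; hence \<open>rad s\<close> is an explicit function of \<open>z\<close>.\<close>

definition disc_const :: "nat \<Rightarrow> real" where
  "disc_const s = (SOME c. c > 0 \<and> (\<forall>v\<in>carrier_vec (2*p). c * nsq v \<le> gform s v))"

lemma disc_const:
  shows "disc_const s > 0" "v \<in> carrier_vec (2*p) \<Longrightarrow> disc_const s * nsq v \<le> gform s v"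
  using someI_ex[OF gform_lower_bound[of s]] by (auto simp: disc_const_def)

abbreviation rad :: "nat \<Rightarrow> complex \<Rightarrow> real" where
  "rad s z \<equiv> disc_bound (disc_const s) z"

text \<open>Apply \<open>disc_diameter\<close> to a unit vector, which selects a column. Note that
  \<open>rad s z / n\<close> bounds a squared distance.\<close>

lemma in_disc_index_diff:
  assumes z: "z \<in> lower_half" and n: "n > 0"
    and d: "in_disc s n z \<phi>" "in_disc s n z \<psi>" and ab: "a < p" "b < p"
  shows "(cmod (\<phi> $$ (a, b) - \<psi> $$ (a, b)))\<^sup>2 \<le> rad s z / n"
proof -
  have \<phi>: "\<phi> \<in> carrier_mat p p" and \<psi>: "\<psi> \<in> carrier_mat p p" using d by (auto simp: in_disc_def)
  have "(\<phi> - \<psi>) \<in> carrier_mat p p" using \<psi> by (rule minus_carrier_mat)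
  hence "\<phi> $$ (a, b) - \<psi> $$ (a, b) = ((\<phi> - \<psi>) *\<^sub>v unit_vec p b) $ a"
    using mult_unit_vec_index[of "\<phi> - \<psi>" p p a b] \<phi> \<psi> ab by simp
  hence "(cmod (\<phi> $$ (a, b) - \<psi> $$ (a, b)))\<^sup>2 \<le> nsq ((\<phi> - \<psi>) *\<^sub>v unit_vec p b)"
    using cmod_index_le_nsq[of a "(\<phi> - \<psi>) *\<^sub>v unit_vec p b"] \<psi> ab by simp
  also have "\<dots> \<le> rad s z / n * nsq (unit_vec p b)"
    using disc_diameter[OF z n disc_const d unit_vec_carrier] .
  also have "nsq (unit_vec p b) = (\<Sum>i<p. if i = b then 1 else 0)"
    unfolding nsq_eq_sum by (intro sum.cong) (use ab in auto)
  also have "\<dots> = 1" using ab by simp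
  finally show ?thesis by simp
qed

text \<open>Gives local boundedness for uniform convergence, and later the passage to a limit point
  in \<open>Weyl_disc_unique\<close>.\<close>

lemma rad_continuous: "continuous_on lower_half (rad s)"
  unfolding disc_bound_def qz_def rz_def using disc_const(1)[of s]
  by (intro continuous_intros) (auto simp: lower_half_def)

definition wlim :: "nat \<Rightarrow> complex \<Rightarrow> complex mat" where
  "wlim s z = mat p p (\<lambda>(a, b). lim (\<lambda>n. centre s (Suc n) z $$ (a, b)))"

lemma wlim_carrier [simp]: "wlim s z \<in> carrier_mat p p"
  by (simp add: wlim_def)

text \<open>By nesting, the later centre also lies in the earlier disc.\<close>

lemma centre_diff:
  assumes z: "z \<in> lower_half" and ab: "a < p" "b < p" and nm: "n \<le> m"
  shows "(cmod (centre s (Suc n) z $$ (a, b) - centre s (Suc m) z $$ (a, b)))\<^sup>2 \<le> rad s z / Suc n"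
proof (rule in_disc_index_diff[OF z _ centre_in_disc[OF z] _ ab])
  show "in_disc s (Suc n) z (centre s (Suc m) z)"
    using centre_in_disc[OF z, of s m] nm in_disc_mono[OF z, of s "Suc n" "m - n"] by simp
qed simp

lemma centre_tendsto:
  assumes z: "z \<in> lower_half" and ab: "a < p" "b < p"
  shows "(\<lambda>n. centre s (Suc n) z $$ (a, b)) \<longlonglongrightarrow> wlim s z $$ (a, b)"
proof -
  let ?f = "\<lambda>n. centre s (Suc n) z $$ (a, b)"
  have "Cauchy ?f"
  proof (rule CauchyI')
    fix e :: real assume e: "e > 0"
    obtain N where N: "rad s z / e\<^sup>2 < real N" using reals_Archimedean2 by blast
    have "dist (?f m) (?f n) < e" if "m \<ge> N" "n > m" for m n
    proof -
      have "rad s z / e\<^sup>2 < Suc m" using N that by simp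
      thus ?thesis using sq_le_divide_Suc_less[OF centre_diff[OF z ab, of m n s] _ e] that
        by (simp add: dist_norm)
    qed
    thus "\<exists>M. \<forall>m\<ge>M. \<forall>n>m. dist (?f m) (?f n) < e" by blast
  qed
  hence "?f \<longlonglongrightarrow> lim ?f" by (simp add: Cauchy_convergent convergent_LIMSEQ_iff[symmetric])
  thus ?thesis using ab by (simp add: wlim_def)
qed

lemma centre_wlim_diff:
  assumes z: "z \<in> lower_half" and ab: "a < p" "b < p"
  shows "(cmod (centre s (Suc n) z $$ (a, b) - wlim s z $$ (a, b)))\<^sup>2 \<le> rad s z / Suc n"
proof (rule tendsto_upperbound)
  show "(\<lambda>m. (cmod (centre s (Suc n) z $$ (a, b) - centre s (Suc m) z $$ (a, b)))\<^sup>2)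
    \<longlonglongrightarrow> (cmod (centre s (Suc n) z $$ (a, b) - wlim s z $$ (a, b)))\<^sup>2"
    by (intro tendsto_intros centre_tendsto z ab)
  show "\<forall>\<^sub>F m in sequentially. (cmod (centre s (Suc n) z $$ (a, b) - centre s (Suc m) z $$ (a, b)))\<^sup>2
    \<le> rad s z / Suc n"
    using eventually_ge_at_top[of n] by eventually_elim (rule centre_diff[OF z ab])
qed simp

text \<open>On a closed ball \<open>rad s\<close> is bounded, so \<open>centre_wlim_diff\<close>
  yields uniform convergence there.\<close>

lemma wlim_holomorphic:
  assumes ab: "a < p" "b < p"
  shows "(\<lambda>z. wlim s z $$ (a, b)) holomorphic_on lower_half"
proof (rule holomorphic_uniform_sequence[OF open_lower_half])
  show "(\<lambda>z. centre s (Suc n) z $$ (a, b)) holomorphic_on lower_half" for n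
    by (rule centre_holomorphic[OF ab])
  fix x assume "x \<in> lower_half"
  then obtain d where d: "d > 0" "cball x d \<subseteq> lower_half"
    using open_lower_half open_contains_cball by blast
  have "compact (rad s ` cball x d)"
    using continuous_on_subset[OF rad_continuous d(2)] by (intro compact_continuous_image) auto
  then obtain B where B: "\<And>w. w \<in> cball x d \<Longrightarrow> rad s w \<le> B"
    using compact_imp_bounded bounded_imp_bdd_above unfolding bdd_above_def by (metis imageI)
  have "uniform_limit (cball x d) (\<lambda>n z. centre s (Suc n) z $$ (a, b)) (\<lambda>z. wlim s z $$ (a, b)) sequentially"
  proof (rule uniform_limitI)
    fix e :: real assume e: "e > 0"
    obtain N where N: "B / e\<^sup>2 < real N" using reals_Archimedean2 by blast
    show "\<forall>\<^sub>F n in sequentially. \<forall>w\<in>cball x d. dist (centre s (Suc n) w $$ (a, b)) (wlim s w $$ (a, b)) < e"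
      using eventually_ge_at_top[of N]
    proof eventually_elim
      case (elim n)
      show ?case
      proof
        fix w assume w: "w \<in> cball x d"
        have "rad s w / e\<^sup>2 \<le> B / e\<^sup>2" using B[OF w] by (intro divide_right_mono) auto
        hence "rad s w / e\<^sup>2 < Suc n" using N elim by simp
        thus "dist (centre s (Suc n) w $$ (a, b)) (wlim s w $$ (a, b)) < e"
          using sq_le_divide_Suc_less[OF centre_wlim_diff[OF _ ab] _ e] w d(2)
          by (auto simp: dist_norm)
      qed
    qed
  qed
  thus "\<exists>d>0. cball x d \<subseteq> lower_half \<and>
      uniform_limit (cball x d) (\<lambda>n z. centre s (Suc n) z $$ (a, b)) (\<lambda>z. wlim s z $$ (a, b)) sequentially"
    using d by blast
qed

lemma tendsto_wlim_mult:
  assumes z: "z \<in> lower_half" and f: "f \<in> carrier_vec p" and i: "i < p"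
  shows "(\<lambda>n. (centre s (Suc n) z *\<^sub>v f) $ i) \<longlonglongrightarrow> (wlim s z *\<^sub>v f) $ i"
  using centre_tendsto[OF z] f i
  by (intro tendsto_mult_mat_vec[of _ p p]) auto

text \<open>Each centre satisfies this because its graph vectors are images of
  \<open>j\<close>-nonpositive vectors; the inequality is closed under limits.\<close>

lemma wlim_accretive:
  assumes z: "z \<in> lower_half" and f: "f \<in> carrier_vec p"
  shows "Re (ip f ((- \<i>) \<cdot>\<^sub>v (wlim s z *\<^sub>v f))) \<le> 0"
proof -
  have c: "centre s (Suc n) z *\<^sub>v f \<in> carrier_vec p" for n by (rule mult_mat_vec_carrier[OF centre_carrier f])
  have w: "wlim s z *\<^sub>v f \<in> carrier_vec p" by (rule mult_mat_vec_carrier[OF wlim_carrier f])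
  have "Re (ip f ((- \<i>) \<cdot>\<^sub>v (centre s (Suc n) z *\<^sub>v f))) \<le> 0" for n
  proof -
    obtain v where v: "v \<in> carrier_vec (2*p)" "jform v \<le> 0"
      "P s (Suc n) z *\<^sub>v v = mat_adjoint (Kmat p) *\<^sub>v (f @\<^sub>v (- \<i>) \<cdot>\<^sub>v (centre s (Suc n) z *\<^sub>v f))"
      using centre_in_disc[OF z, of s n] f unfolding in_disc_def by blast
    have "(- \<i>) \<cdot>\<^sub>v (centre s (Suc n) z *\<^sub>v f) \<in> carrier_vec p" using c by simp
    thus ?thesis using jform_P_nonpos[OF z v(1,2), of s "Suc n"]
      unfolding v(3) by (subst (asm) j_form_adjoint_Kmat[OF f]) auto
  qed
  moreover have "(\<lambda>n. Re (ip f ((- \<i>) \<cdot>\<^sub>v (centre s (Suc n) z *\<^sub>v f)))) \<longlonglongrightarrow>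
      Re (ip f ((- \<i>) \<cdot>\<^sub>v (wlim s z *\<^sub>v f)))"
    unfolding ip_smult_right unfolding ip_def carrier_vecD[OF c] carrier_vecD[OF w]
    by (intro tendsto_intros tendsto_wlim_mult z f) auto
  ultimately show ?thesis using LIMSEQ_le_const2 by blast
qed

text \<open>\<open>wR\<close> and \<open>wQ\<close> are the two halves of the adjoint of
  \<open>Kmat p\<close> applied to the column with entries \<open>1\<close> and
  \<open>- \<i> wlim\<close>, so this pair encodes the limit of the tail system.\<close>

abbreviation wR :: "nat \<Rightarrow> complex \<Rightarrow> complex mat" where
  "wR s z \<equiv> complex_of_real (1 / sqrt 2) \<cdot>\<^sub>m (1\<^sub>m p + (- \<i>) \<cdot>\<^sub>m wlim s z)"
abbreviation wQ :: "nat \<Rightarrow> complex \<Rightarrow> complex mat" where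
  "wQ s z \<equiv> complex_of_real (1 / sqrt 2) \<cdot>\<^sub>m ((- \<i>) \<cdot>\<^sub>m wlim s z - 1\<^sub>m p)"

lemma wRQ_mult:
  assumes y: "y \<in> carrier_vec p"
  shows "(wR s z *\<^sub>v y) @\<^sub>v (wQ s z *\<^sub>v y) =
    mat_adjoint (Kmat p) *\<^sub>v (y @\<^sub>v (- \<i>) \<cdot>\<^sub>v (wlim s z *\<^sub>v y))"
proof -
  let ?W = "(- \<i>) \<cdot>\<^sub>m wlim s z"
  have W: "?W \<in> carrier_mat p p" by simp
  have sm: "(c \<cdot>\<^sub>m A) *\<^sub>v y = c \<cdot>\<^sub>v (A *\<^sub>v y)" if "A \<in> carrier_mat p p" for c and A :: "complex mat"
    using that y by (intro eq_vecI) auto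
  have "wR s z *\<^sub>v y = complex_of_real (1 / sqrt 2) \<cdot>\<^sub>v (y + (- \<i>) \<cdot>\<^sub>v (wlim s z *\<^sub>v y))"
    using y by (simp add: sm[OF add_carrier_mat[OF W]] add_mult_distrib_mat_vec[OF one_carrier_mat W y]
        sm[OF wlim_carrier] del: of_real_divide)
  moreover have "wQ s z *\<^sub>v y = complex_of_real (1 / sqrt 2) \<cdot>\<^sub>v ((- \<i>) \<cdot>\<^sub>v (wlim s z *\<^sub>v y) - y)"
    using y by (simp add: sm[OF minus_carrier_mat[OF one_carrier_mat]] minus_mult_distrib_mat_vec[OF W one_carrier_mat y]
        sm[OF wlim_carrier] del: of_real_divide)
  ultimately show ?thesis
    using y mult_mat_vec_carrier[OF wlim_carrier y]
    by (simp add: adjoint_Kmat_mult_append del: of_real_divide)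
qed

lemma wRQ_carrier [simp]: "wR s z \<in> carrier_mat p p" "wQ s z \<in> carrier_mat p p"
  by (auto intro!: minus_carrier_mat)

text \<open>The first inequality is \<open>wlim_accretive\<close> in the coordinates of
  \<open>j\<close>. As the adjoint of \<open>Kmat p\<close> preserves norms, the two squares add up
  to something positive, and the larger one must be positive.\<close>

lemma good_pair_wRQ:
  assumes z: "z \<in> lower_half"
  shows "good_pair (wR s z) (wQ s z)"
  unfolding good_pair_def
proof (intro conjI ballI impI wRQ_carrier)
  fix y :: "complex vec" assume y: "y \<in> carrier_vec p"
  let ?g = "(- \<i>) \<cdot>\<^sub>v (wlim s z *\<^sub>v y)"
  have g: "?g \<in> carrier_vec p" using mult_mat_vec_carrier[OF wlim_carrier y] by simp
  have R: "wR s z *\<^sub>v y \<in> carrier_vec p" and Q: "wQ s z *\<^sub>v y \<in> carrier_vec p"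
    using mult_mat_vec_carrier[OF wRQ_carrier(1) y] mult_mat_vec_carrier[OF wRQ_carrier(2) y] .
  have "jform ((wR s z *\<^sub>v y) @\<^sub>v (wQ s z *\<^sub>v y)) \<le> 0"
    unfolding wRQ_mult[OF y] j_form_adjoint_Kmat[OF y g] using wlim_accretive[OF z y, of s] by simp
  thus le: "nsq (wR s z *\<^sub>v y) \<le> nsq (wQ s z *\<^sub>v y)" unfolding jform_append[OF R Q] by simp
  assume "y \<noteq> 0\<^sub>v p"
  hence "nsq y > 0" using nsq_nonneg[of y] nsq_eq_0_iff[OF y] by linarith
  moreover have "nsq (wR s z *\<^sub>v y) + nsq (wQ s z *\<^sub>v y) = nsq y + nsq ?g"
    using nsq_adjoint_Kmat[OF y g] ip_append[OF R Q R Q] unfolding wRQ_mult[OF y, symmetric] by simp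
  ultimately show "nsq (wQ s z *\<^sub>v y) > 0" using le nsq_nonneg[of ?g] by linarith
qed

text \<open>Both sides are limits of the corresponding identity for the centres, since
  \<open>P 0 (n + m) = P 0 n * P n m\<close>.\<close>

lemma wlim_recursion:
  assumes z: "z \<in> lower_half"
  shows "wlim 0 z * top_fac p (Kmat p * P 0 (Suc N) z) (wR (Suc N) z) (wQ (Suc N) z) =
    \<i> \<cdot>\<^sub>m bot_fac p (Kmat p * P 0 (Suc N) z) (wR (Suc N) z) (wQ (Suc N) z)"
proof -
  let ?M = "Kmat p * P 0 (Suc N) z"
  let ?D = "top_fac p ?M (wR (Suc N) z) (wQ (Suc N) z)" and ?U = "bot_fac p ?M (wR (Suc N) z) (wQ (Suc N) z)"
  note M = KP_carrier[of 0 "Suc N" z]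
  note Ka = mat_adjoint_carrier[OF Kmat_carrier[of p]]
  note DU = fac_carrier[OF M wRQ_carrier]
  have D: "?D \<in> carrier_mat p p" and U: "?U \<in> carrier_mat p p" using DU by auto
  have main: "?U *\<^sub>v f = (- \<i>) \<cdot>\<^sub>v (wlim 0 z *\<^sub>v (?D *\<^sub>v f))" if f: "f \<in> carrier_vec p" for f
  proof -
    define x where "x n = f @\<^sub>v (- \<i>) \<cdot>\<^sub>v (centre (Suc N) (Suc n) z *\<^sub>v f)" for n
    define x' where "x' = f @\<^sub>v (- \<i>) \<cdot>\<^sub>v (wlim (Suc N) z *\<^sub>v f)"
    define w where "w n = ?M *\<^sub>v (mat_adjoint (Kmat p) *\<^sub>v x n)" for n
    define w' where "w' = ?M *\<^sub>v (mat_adjoint (Kmat p) *\<^sub>v x')"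
    have x: "x n \<in> carrier_vec (2*p)" for n
      unfolding x_def using f mult_mat_vec_carrier[OF centre_carrier f] by simp
    have x': "x' \<in> carrier_vec (2*p)"
      unfolding x'_def using f mult_mat_vec_carrier[OF wlim_carrier f] by simp
    have w: "w n \<in> carrier_vec (2*p)" for n
      unfolding w_def by (rule mult_mat_vec_carrier[OF M mult_mat_vec_carrier[OF Ka x]])
    have w'_eq: "w' = (?D *\<^sub>v f) @\<^sub>v (?U *\<^sub>v f)"
      unfolding w'_def x'_def wRQ_mult[OF f, symmetric] by (rule fac_mult[OF M wRQ_carrier f])
    have Df: "?D *\<^sub>v f \<in> carrier_vec p" and Uf: "?U *\<^sub>v f \<in> carrier_vec p"
      using mult_mat_vec_carrier[OF D f] mult_mat_vec_carrier[OF U f] .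
    have tx: "(\<lambda>n. x n $ i) \<longlonglongrightarrow> x' $ i" if i: "i < 2*p" for i
    proof (cases "i < p")
      case True
      thus ?thesis using f by (simp add: x_def x'_def)
    next
      case False
      hence "(\<lambda>n. - \<i> * (centre (Suc N) (Suc n) z *\<^sub>v f) $ (i - p)) \<longlonglongrightarrow> - \<i> * (wlim (Suc N) z *\<^sub>v f) $ (i - p)"
        using i by (intro tendsto_intros tendsto_wlim_mult z f) auto
      moreover have "x n $ i = - \<i> * (centre (Suc N) (Suc n) z *\<^sub>v f) $ (i - p)" for n
        using False i f carrier_matD[OF centre_carrier[of "Suc N" "Suc n" z]]
        by (simp add: x_def del: index_mult_mat_vec)
      moreover have "x' $ i = - \<i> * (wlim (Suc N) z *\<^sub>v f) $ (i - p)"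
        using False i f carrier_matD[OF wlim_carrier[of "Suc N" z]]
        by (simp add: x'_def del: index_mult_mat_vec)
      ultimately show ?thesis by simp
    qed
    have tw: "(\<lambda>n. w n $ i) \<longlonglongrightarrow> w' $ i" if "i < 2*p" for i
      unfolding w_def w'_def using that tx x x'
      by (intro tendsto_mult_mat_vec[of _ "2*p" "2*p"] mult_mat_vec_carrier[OF Ka] tendsto_const M Ka) auto
    \<comment> \<open>Choosing \<open>y\<close> so that the tail denominator sends it to
      \<open>f\<close> makes \<open>w n\<close> the image of the vector with halves \<open>0\<close>
      and \<open>y\<close> under the full product of \<open>N + 1\<close> plus \<open>n + 1\<close>
      factors. It therefore lies on the graph of the corresponding centre.\<close>
    have rel: "w n = vec_first (w n) p @\<^sub>v (- \<i>) \<cdot>\<^sub>v (centre 0 (Suc (Suc N + n)) z *\<^sub>v vec_first (w n) p)" for n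
    proof -
      let ?L = "Suc (Suc N + n)"
      obtain y where y: "y \<in> carrier_vec p" "Dc (Suc N) (Suc n) z *\<^sub>v y = f"
        using mult_mat_vec_surj[OF Dc_carrier det_top_fac[OF z good_pair_01] f] by blast
      let ?v = "(0\<^sub>m p p *\<^sub>v y) @\<^sub>v (1\<^sub>m p *\<^sub>v y)"
      have v: "?v \<in> carrier_vec (2*p)" using good_pair_vec[OF good_pair_01 y(1)] by simp
      have 1: "P (Suc N) (Suc n) z *\<^sub>v ?v = mat_adjoint (Kmat p) *\<^sub>v x n"
        unfolding P_mult_pair[OF zero_carrier_mat one_carrier_mat y(1)] x_def
          bot_fac_mult[OF zero_carrier_mat one_carrier_mat centre_carrier KP_carrier centre_eq[OF z] y(1)] y(2) ..
      have 2: "P 0 ?L z *\<^sub>v ?v = P 0 (Suc N) z *\<^sub>v (mat_adjoint (Kmat p) *\<^sub>v x n)"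
        using P_add_mult[OF v, of 0 "Suc N" "Suc n" z] 1 by simp
      have "w n = Kmat p *\<^sub>v (P 0 ?L z *\<^sub>v ?v)"
        unfolding w_def 2 by (rule KP_mult[OF mult_mat_vec_carrier[OF Ka x]])
      also have "\<dots> = (Kmat p * P 0 ?L z) *\<^sub>v ?v" by (rule KP_mult[OF v, symmetric])
      also have "\<dots> = (Dc 0 ?L z *\<^sub>v y) @\<^sub>v (Uc 0 ?L z *\<^sub>v y)"
        by (rule fac_mult[OF KP_carrier zero_carrier_mat one_carrier_mat y(1)])
      also have "Uc 0 ?L z *\<^sub>v y = (- \<i>) \<cdot>\<^sub>v (centre 0 ?L z *\<^sub>v (Dc 0 ?L z *\<^sub>v y))"
        by (rule bot_fac_mult[OF zero_carrier_mat one_carrier_mat centre_carrier KP_carrier centre_eq[OF z] y(1)])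
      finally have e: "w n = (Dc 0 ?L z *\<^sub>v y) @\<^sub>v (- \<i>) \<cdot>\<^sub>v (centre 0 ?L z *\<^sub>v (Dc 0 ?L z *\<^sub>v y))" .
      have "vec_first (w n) p = Dc 0 ?L z *\<^sub>v y"
        unfolding e vec_first_def using carrier_vecD[OF mult_mat_vec_carrier[OF Dc_carrier[of 0 ?L z] y(1)]]
        by (intro eq_vecI) (auto simp del: index_mult_mat_vec dim_mult_mat_vec)
      thus ?thesis using e by simp
    qed
    have tc: "(\<lambda>n. centre 0 (Suc (Suc N + n)) z $$ (i, l)) \<longlonglongrightarrow> wlim 0 z $$ (i, l)" if "i < p" "l < p" for i l
      using LIMSEQ_ignore_initial_segment[OF centre_tendsto[OF z that, of 0], of "Suc N"]
      by (simp add: add.commute)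
    show ?thesis
    proof (rule eq_vecI)
      fix i assume "i < dim_vec ((- \<i>) \<cdot>\<^sub>v (wlim 0 z *\<^sub>v (?D *\<^sub>v f)))"
      hence i: "i < p" using carrier_matD[OF wlim_carrier[of 0 z]] by simp
      have "(\<lambda>n. - \<i> * (centre 0 (Suc (Suc N + n)) z *\<^sub>v vec_first (w n) p) $ i) \<longlonglongrightarrow>
          - \<i> * (wlim 0 z *\<^sub>v (?D *\<^sub>v f)) $ i"
      proof (intro tendsto_intros tendsto_mult_mat_vec[of _ p p] tc i Df)
        fix l assume l: "l < p"
        have "(\<lambda>n. w n $ l) \<longlonglongrightarrow> w' $ l" using l by (intro tw) auto
        thus "(\<lambda>n. vec_first (w n) p $ l) \<longlonglongrightarrow> (?D *\<^sub>v f) $ l"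
          using l carrier_vecD[OF Df] by (simp add: w'_eq vec_first_def del: index_mult_mat_vec)
      qed auto
      moreover have "w n $ (p + i) = - \<i> * (centre 0 (Suc (Suc N + n)) z *\<^sub>v vec_first (w n) p) $ i" for n
        using i carrier_matD[OF centre_carrier[of 0 "Suc (Suc N + n)" z]]
        by (subst rel) (simp del: index_mult_mat_vec)
      ultimately have "(\<lambda>n. w n $ (p + i)) \<longlonglongrightarrow> - \<i> * (wlim 0 z *\<^sub>v (?D *\<^sub>v f)) $ i" by simp
      moreover have "(\<lambda>n. w n $ (p + i)) \<longlonglongrightarrow> (?U *\<^sub>v f) $ i"
        using tw[of "p + i"] i carrier_vecD[OF Df] carrier_vecD[OF Uf]
        by (simp add: w'_eq del: index_mult_mat_vec dim_mult_mat_vec)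
      ultimately have "(?U *\<^sub>v f) $ i = - \<i> * (wlim 0 z *\<^sub>v (?D *\<^sub>v f)) $ i"
        using LIMSEQ_unique by blast
      thus "(?U *\<^sub>v f) $ i = ((- \<i>) \<cdot>\<^sub>v (wlim 0 z *\<^sub>v (?D *\<^sub>v f))) $ i"
        using i carrier_matD[OF wlim_carrier[of 0 z]] by (simp del: index_mult_mat_vec)
    qed (use carrier_matD[OF U] in \<open>simp add: carrier_matD[OF wlim_carrier] del: P.simps of_real_divide\<close>)
  qed
  show ?thesis
  proof (rule mat_eqI_vec)
    show "wlim 0 z * ?D \<in> carrier_mat p p" by (rule mult_carrier_mat[OF wlim_carrier D])
    show "\<i> \<cdot>\<^sub>m ?U \<in> carrier_mat p p" using U by simp
    fix f :: "complex vec" assume f: "f \<in> carrier_vec p"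
    have "(\<i> \<cdot>\<^sub>m ?U) *\<^sub>v f = \<i> \<cdot>\<^sub>v (?U *\<^sub>v f)" using U f by (intro eq_vecI) auto
    also have "\<dots> = wlim 0 z *\<^sub>v (?D *\<^sub>v f)" unfolding main[OF f] by (simp add: smult_smult_assoc)
    finally show "(wlim 0 z * ?D) *\<^sub>v f = (\<i> \<cdot>\<^sub>m ?U) *\<^sub>v f"
      using assoc_mult_mat_vec[OF wlim_carrier D f] by simp
  qed
qed

section \<open>From pointwise discs back to the sets \<open>Weyl_disc\<close>\<close>

lemma gram_form:
  fixes A :: "complex mat"
  assumes A: "A \<in> carrier_mat p p" and v: "v \<in> carrier_vec p"
  shows "ip v ((mat_adjoint A * A) *\<^sub>v v) = ip (A *\<^sub>v v) (A *\<^sub>v v)"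
  unfolding assoc_mult_mat_vec[OF mat_adjoint_carrier[OF A] A v]
  using ip_mat_adjoint[OF mat_adjoint_carrier[OF A] v mult_mat_vec_carrier[OF A v]] by simp

text \<open>The form of \<open>mat_adjoint A * A\<close> at \<open>v\<close> is
  \<open>nsq (A v)\<close>, so both matrix inequalities become inequalities between
  \<open>nsq (R v)\<close> and \<open>nsq (Q v)\<close>.\<close>

lemma good_pair_iff:
  assumes R: "R \<in> carrier_mat p p" and Q: "Q \<in> carrier_mat p p"
  shows "pos_def_mat p (mat_adjoint R * R + mat_adjoint Q * Q) \<and>
    pos_semidef_mat p (mat_adjoint Q * Q - mat_adjoint R * R) \<longleftrightarrow> good_pair R Q"
proof -
  note Ra = mat_adjoint_carrier[OF R] and Qa = mat_adjoint_carrier[OF Q]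
  note RR = mult_carrier_mat[OF Ra R] and QQ = mult_carrier_mat[OF Qa Q]
  have s: "mat_adjoint R * R + mat_adjoint Q * Q \<in> carrier_mat p p"
    and d: "mat_adjoint Q * Q - mat_adjoint R * R \<in> carrier_mat p p"
    using RR QQ by (auto intro: minus_carrier_mat)
  have fs: "conjugate v \<bullet> ((mat_adjoint R * R + mat_adjoint Q * Q) *\<^sub>v v) =
      ip (R *\<^sub>v v) (R *\<^sub>v v) + ip (Q *\<^sub>v v) (Q *\<^sub>v v)"
    and fd: "conjugate v \<bullet> ((mat_adjoint Q * Q - mat_adjoint R * R) *\<^sub>v v) =
      ip (Q *\<^sub>v v) (Q *\<^sub>v v) - ip (R *\<^sub>v v) (R *\<^sub>v v)" if v: "v \<in> carrier_vec p" for v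
  proof -
    note RRv = mult_mat_vec_carrier[OF RR v] and QQv = mult_mat_vec_carrier[OF QQ v]
    have "conjugate v \<bullet> ((mat_adjoint R * R + mat_adjoint Q * Q) *\<^sub>v v) =
        ip v ((mat_adjoint R * R + mat_adjoint Q * Q) *\<^sub>v v)"
      by (rule scalar_prod_conjugate_eq_ip) (use v Q in simp)
    thus "conjugate v \<bullet> ((mat_adjoint R * R + mat_adjoint Q * Q) *\<^sub>v v) =
      ip (R *\<^sub>v v) (R *\<^sub>v v) + ip (Q *\<^sub>v v) (Q *\<^sub>v v)"
      by (simp add: add_mult_distrib_mat_vec[OF RR QQ v] ip_add_right[OF RRv QQv] gram_form[OF R v] gram_form[OF Q v])
    have "conjugate v \<bullet> ((mat_adjoint Q * Q - mat_adjoint R * R) *\<^sub>v v) =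
        ip v ((mat_adjoint Q * Q - mat_adjoint R * R) *\<^sub>v v)"
      by (rule scalar_prod_conjugate_eq_ip) (use v R in simp)
    thus "conjugate v \<bullet> ((mat_adjoint Q * Q - mat_adjoint R * R) *\<^sub>v v) =
      ip (Q *\<^sub>v v) (Q *\<^sub>v v) - ip (R *\<^sub>v v) (R *\<^sub>v v)"
      by (simp add: minus_mult_distrib_mat_vec[OF QQ RR v] ip_diff_right[OF QQv RRv] gram_form[OF R v] gram_form[OF Q v])
  qed
  have "mat_adjoint (mat_adjoint R * R + mat_adjoint Q * Q) = mat_adjoint R * R + mat_adjoint Q * Q"
    "mat_adjoint (mat_adjoint Q * Q - mat_adjoint R * R) = mat_adjoint Q * Q - mat_adjoint R * R"
    by (simp_all add: mat_adjoint_plus[OF RR QQ] mat_adjoint_minus[OF QQ RR]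
        mat_adjoint_mult[OF Ra R] mat_adjoint_mult[OF Qa Q])
  hence "pos_def_mat p (mat_adjoint R * R + mat_adjoint Q * Q) \<and>
    pos_semidef_mat p (mat_adjoint Q * Q - mat_adjoint R * R) \<longleftrightarrow>
    (\<forall>v\<in>carrier_vec p. (v \<noteq> 0\<^sub>v p \<longrightarrow> nsq (R *\<^sub>v v) + nsq (Q *\<^sub>v v) > 0) \<and> nsq (R *\<^sub>v v) \<le> nsq (Q *\<^sub>v v))"
    unfolding pos_def_mat_def pos_semidef_mat_def using s d by (auto simp: fs fd)
  also have "\<dots> \<longleftrightarrow> good_pair R Q"
  proof -
    have "(nsq (R *\<^sub>v v) + nsq (Q *\<^sub>v v) > 0 \<and> nsq (R *\<^sub>v v) \<le> nsq (Q *\<^sub>v v)) \<longleftrightarrow>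
      (nsq (R *\<^sub>v v) \<le> nsq (Q *\<^sub>v v) \<and> nsq (Q *\<^sub>v v) > 0)" for v
      using nsq_nonneg[of "R *\<^sub>v v"] by linarith
    thus ?thesis unfolding good_pair_def using R Q by blast
  qed
  finally show ?thesis .
qed

lemma calW_fac:
  "calW11 p \<beta> N z * R + calW12 p \<beta> N z * Q = top_fac p (Kmat p * P 0 (Suc N) z) R Q"
  "calW21 p \<beta> N z * R + calW22 p \<beta> N z * Q = bot_fac p (Kmat p * P 0 (Suc N) z) R Q"
  unfolding calW11_def calW12_def calW21_def calW22_def calW_eq top_fac_def bot_fac_def by simp_all

text \<open>The pair attached to the system started at \<open>N + 1\<close> is holomorphic in the
  whole half-plane, so the conditions can be checked at every point.\<close>

lemma wlim_in_Weyl_disc: "wlim 0 \<in> Weyl_disc p \<beta> N"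
proof -
  let ?R = "wR (Suc N)" and ?Q = "wQ (Suc N)"
  have hR: "(\<lambda>z. ?R z $$ (a, b)) holomorphic_on lower_half"
    and hQ: "(\<lambda>z. ?Q z $$ (a, b)) holomorphic_on lower_half" if "a < p" "b < p" for a b
  proof -
    have "(\<lambda>z. complex_of_real (1 / sqrt 2) * (1\<^sub>m p $$ (a, b) + - \<i> * wlim (Suc N) z $$ (a, b))) holomorphic_on lower_half"
      "(\<lambda>z. complex_of_real (1 / sqrt 2) * (- \<i> * wlim (Suc N) z $$ (a, b) - 1\<^sub>m p $$ (a, b))) holomorphic_on lower_half"
      by (intro holomorphic_intros wlim_holomorphic that)+
    thus "(\<lambda>z. ?R z $$ (a, b)) holomorphic_on lower_half" "(\<lambda>z. ?Q z $$ (a, b)) holomorphic_on lower_half"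
      using that by (simp_all add: carrier_matD[OF wlim_carrier] del: of_real_divide)
  qed
  have i: "- \<i> \<in> lower_half" by (simp add: lower_half_def)
  have "mat_holomorphic_on p (wlim 0) lower_half"
    by (simp add: mat_holomorphic_on_def wlim_holomorphic)
  moreover have "mat_meromorphic_on p ?R lower_half" "mat_meromorphic_on p ?Q lower_half"
    using mat_meromorphic_onI[OF hR open_lower_half] mat_meromorphic_onI[OF hQ open_lower_half] wRQ_carrier by blast+
  moreover have "mat_analytic_at p ?R (- \<i>)" "mat_analytic_at p ?Q (- \<i>)"
    using mat_analytic_atI[OF hR open_lower_half i] mat_analytic_atI[OF hQ open_lower_half i] by blast+
  moreover have "pos_def_mat p (mat_adjoint (?R z) * ?R z + mat_adjoint (?Q z) * ?Q z) \<and>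
     pos_semidef_mat p (mat_adjoint (?Q z) * ?Q z - mat_adjoint (?R z) * ?R z) \<and>
     (let D = calW11 p \<beta> N z * ?R z + calW12 p \<beta> N z * ?Q z;
          U = calW21 p \<beta> N z * ?R z + calW22 p \<beta> N z * ?Q z
      in det D \<noteq> 0 \<and> wlim 0 z = \<i> \<cdot>\<^sub>m (U * the (mat_inverse D)))" if z: "z \<in> lower_half" for z
  proof -
    note g = good_pair_wRQ[OF z, of "Suc N"]
    note DU = fac_carrier[OF KP_carrier[of 0 "Suc N" z] wRQ_carrier[of "Suc N" z]]
    show ?thesis
      unfolding calW_fac Let_def
      using good_pair_iff[OF wRQ_carrier, of "Suc N" z "Suc N" z] g det_top_fac[OF z g, of 0 N]
        fraction_iff[OF DU(1) det_top_fac[OF z g, of 0 N] DU(2) wlim_carrier[of 0 z]] wlim_recursion[OF z, of N]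
      by blast
  qed
  ultimately show ?thesis unfolding Weyl_disc_def mem_Collect_eq by blast
qed

text \<open>The parameter pair gives information only where it is analytic, hence on a punctured
  neighbourhood of \<open>z\<close>.\<close>

lemma Weyl_disc_eventually_in_disc:
  assumes w: "\<psi> \<in> Weyl_disc p \<beta> N" and z: "z \<in> lower_half"
  shows "eventually (\<lambda>w. in_disc 0 (Suc N) w (\<psi> w)) (at z)"
proof -
  obtain R Q where RQ: "mat_meromorphic_on p R lower_half" "mat_meromorphic_on p Q lower_half"
    and pq: "\<And>z. z \<in> lower_half \<Longrightarrow> mat_analytic_at p R z \<Longrightarrow> mat_analytic_at p Q z \<Longrightarrow>
           pos_def_mat p (mat_adjoint (R z) * R z + mat_adjoint (Q z) * Q z) \<and>
           pos_semidef_mat p (mat_adjoint (Q z) * Q z - mat_adjoint (R z) * R z) \<and>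
           \<psi> z = \<i> \<cdot>\<^sub>m (bot_fac p (Kmat p * P 0 (Suc N) z) (R z) (Q z) *
             the (mat_inverse (top_fac p (Kmat p * P 0 (Suc N) z) (R z) (Q z))))"
    using w unfolding Weyl_disc_def mem_Collect_eq calW_fac Let_def by blast
  have \<psi>: "\<psi> w \<in> carrier_mat p p" if "w \<in> lower_half" for w
    using w that by (auto simp: Weyl_disc_def mat_holomorphic_on_def)
  have "eventually (\<lambda>w. w \<in> lower_half) (at z)"
    using open_lower_half z by (rule eventually_at_in_open')
  with mat_meromorphic_eventually_analytic[OF RQ(1) z] mat_meromorphic_eventually_analytic[OF RQ(2) z]
  show ?thesis
  proof eventually_elim
    case (elim w)
    have c: "R w \<in> carrier_mat p p" "Q w \<in> carrier_mat p p"
      using RQ elim(3) by (auto simp: mat_meromorphic_on_def)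
    have g: "good_pair (R w) (Q w)" using pq[OF elim(3,1,2)] good_pair_iff[OF c] by blast
    note DU = fac_carrier[OF KP_carrier[of 0 "Suc N" w] c]
    show ?case
      using pq[OF elim(3,1,2)] fraction_iff[OF DU(1) det_top_fac[OF elim(3) g, of 0 N] DU(2) \<psi>[OF elim(3)]]
      by (intro in_disc_fraction[OF elim(3) g \<psi>[OF elim(3)]]) blast
  qed
qed

lemma wlim_in_disc: "z \<in> lower_half \<Longrightarrow> in_disc 0 (Suc N) z (wlim 0 z)"
  by (rule in_disc_fraction[OF _ good_pair_wRQ wlim_carrier wlim_recursion])

lemma Weyl_disc_unique:
  assumes \<psi>: "\<And>N. \<psi> \<in> Weyl_disc p \<beta> N" and z: "z \<in> lower_half"
  shows "\<psi> z = wlim 0 z"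
proof -
  have hol: "mat_holomorphic_on p \<psi> lower_half" using \<psi>[of 0] by (simp add: Weyl_disc_def)
  have c: "\<psi> z \<in> carrier_mat p p" using hol z by (auto simp: mat_holomorphic_on_def)
  have "\<psi> z $$ (a, b) = wlim 0 z $$ (a, b)" if ab: "a < p" "b < p" for a b
  proof -
    have h: "(\<lambda>w. \<psi> w $$ (a, b)) holomorphic_on lower_half"
      using hol ab by (auto simp: mat_holomorphic_on_def)
    have t: "((\<lambda>w. \<psi> w $$ (a, b)) \<longlongrightarrow> \<psi> z $$ (a, b)) (at z)"
      "((\<lambda>w. wlim 0 w $$ (a, b)) \<longlongrightarrow> wlim 0 z $$ (a, b)) (at z)"
      "(rad 0 \<longlongrightarrow> rad 0 z) (at z)"
      using holomorphic_on_imp_continuous_on[OF h] holomorphic_on_imp_continuous_on[OF wlim_holomorphic[OF ab, of 0]]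
        rad_continuous[of 0] z at_within_open[OF z open_lower_half]
      unfolding continuous_on_def by fastforce+
    \<comment> \<open>The comparison holds near \<open>z\<close>; continuity of both functions and
      of \<open>rad 0\<close> carries it to \<open>z\<close> itself, which may be a pole of the pair
      belonging to this \<open>N\<close>.\<close>
    have le: "(cmod (\<psi> z $$ (a, b) - wlim 0 z $$ (a, b)))\<^sup>2 \<le> rad 0 z / Suc N" for N
    proof (rule tendsto_le)
      show "((\<lambda>w. rad 0 w / Suc N) \<longlongrightarrow> rad 0 z / Suc N) (at z)"
        by (intro tendsto_intros t) simp
      show "((\<lambda>w. (cmod (\<psi> w $$ (a, b) - wlim 0 w $$ (a, b)))\<^sup>2) \<longlongrightarrow>
          (cmod (\<psi> z $$ (a, b) - wlim 0 z $$ (a, b)))\<^sup>2) (at z)"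
        by (intro tendsto_intros t)
      have "eventually (\<lambda>w. w \<in> lower_half) (at z)"
        using open_lower_half z by (rule eventually_at_in_open')
      with Weyl_disc_eventually_in_disc[OF \<psi>[of N] z]
      show "\<forall>\<^sub>F w in at z. (cmod (\<psi> w $$ (a, b) - wlim 0 w $$ (a, b)))\<^sup>2 \<le> rad 0 w / Suc N"
        by eventually_elim (rule in_disc_index_diff[OF _ _ _ wlim_in_disc ab]; simp)
    qed simp
    have "(\<lambda>N. rad 0 z / Suc N) \<longlonglongrightarrow> 0"
      using LIMSEQ_Suc[OF lim_const_over_n[of "rad 0 z"]] by simp
    hence "(cmod (\<psi> z $$ (a, b) - wlim 0 z $$ (a, b)))\<^sup>2 \<le> 0"
      by (rule LIMSEQ_le_const) (use le in blast)
    thus ?thesis by simp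
  qed
  thus ?thesis using c carrier_matD[OF wlim_carrier[of 0 z]] by (intro eq_matI) auto
qed

end

text \<open>Membership in a disc constrains a function on \<open>lower_half\<close> only, so
  uniqueness is equality on that set.\<close>

theorem theorem6p4:
  fixes p :: nat and \<beta> :: "nat \<Rightarrow> complex mat"
  assumes "p \<ge> 1"
    and "\<And>k. \<beta> k \<in> carrier_mat p (2 * p)"
    and "\<And>k. \<beta> k * Jmat p * mat_adjoint (\<beta> k) = 1\<^sub>m p"
  shows "\<exists>\<phi>_inf. (\<forall>N. \<phi>_inf \<in> Weyl_disc p \<beta> N) \<and>
           (\<forall>\<psi>. (\<forall>N. \<psi> \<in> Weyl_disc p \<beta> N) \<longrightarrow> (\<forall>z\<in>lower_half. \<psi> z = \<phi>_inf z))"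
proof -
  interpret discrete_dirac p \<beta> using assms by unfold_locales auto
  show ?thesis using wlim_in_Weyl_disc Weyl_disc_unique by blast
qed

end
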